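(* There exist a reflexive Banach space $Y$ and a variationally McShane integrable multifunction $\Gamma:[0,1]\to cwk(Y)$ such that $0\in\Gamma(t)$ for each $t\in[0,1]$ and $\Gamma$ possesses a scalarly measurable selection that fails to be Henstock integrable.
   Context: $[0,1]$ carries Lebesgue measure; $\mathcal{I}$ is the family of closed subintervals of $[0,1]$, $|I|$ the length of $I$. $cwk(Y)$ is the family of all non-empty convex weakly compact subsets of $Y$, with Minkowski addition, multiplication by scalars, and the Hausdorff distance $d_H$. A function $f:[0,1]\to Y$ is a selection of $\Gamma$ if $f(t)\in\Gamma(t)$ for every $t\in[0,1]$; it is scalarly measurable if $y^*f$ is measurable for every $y^*\in Y^*$. A gauge is a function $\delta:[0,1]\to(0,\infty)$. A partition of $[0,1]$ is a finite collection $\{(I_1,t_1),\dots,(I_p,t_p)\}$ of non-overlapping closed subintervals with union $[0,1]$ and points $t_i\in[0,1]$; it is a Perron partition if $t_i\in I_i$ for all $i$; it is $\delta$-fine if $I_i\subset(t_i-\delta(t_i),t_i+\delta(t_i))$ for all $i$. $\Gamma:[0,1]\to cwk(Y)$ is variationally McShane integrable if there is a finitely additive $\Phi_\Gamma:\mathcal{I}\to cwk(Y)$ such that for every $\varepsilon>0$ there is a gauge $\delta$ with $\sum_{j=1}^p d_H(\Phi_\Gamma(I_j),\Gamma(t_j)|I_j|)<\varepsilon$ for every $\delta$-fine partition of $[0,1]$. A function $f:[0,1]\to Y$ is Henstock integrable if there is $y\in Y$ such that for every $\varepsilon>0$ there is a gauge $\delta$ with $\|y-\sum_{i=1}^p f(t_i)|I_i|\|<\varepsilon$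 for every $\delta$-fine Perron partition of $[0,1]$. The result is under ZFC. *)

theory Defs
  imports "HOL-Analysis.Analysis" "HOL-Library.Function_Algebras" "HOL-Library.Set_Algebras"
begin

text \<open>
  The pointwise vector space structure on real-valued functions. It is needed twice: dual spaces
  are subspaces of a function space, and function spaces serve as ambient vector spaces.
\<close>

instantiation "fun" :: (type, real_vector) real_vector
begin

definition scaleR_fun :: "real \<Rightarrow> ('a \<Rightarrow> 'b) \<Rightarrow> 'a \<Rightarrow> 'b"
  where "scaleR_fun c f = (\<lambda>x. c *\<^sub>R f x)"

instance
  by standard (auto simp: scaleR_fun_def fun_eq_iff algebra_simps)

end

lemma scaleR_fun_apply [simp]: "(c *\<^sub>R f) x = c *\<^sub>R f x" for f :: "'a \<Rightarrow> 'b::real_vector"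
  by (simp add: scaleR_fun_def)


section \<open>Real Banach spaces, their duals, and reflexivity\<close>

text \<open>
  HOL cannot quantify existentially over types, so a Banach space is not represented by a type of
  class \<open>banach\<close> but by a pair \<open>(V, N)\<close>: a linear subspace \<open>V\<close> of an ambient real vector space
  and an arbitrary complete norm \<open>N\<close> on \<open>V\<close>. The ambient type contributes only the linear
  operations; no norm or topology on it is involved, and the values of \<open>N\<close> outside \<open>V\<close> are
  irrelevant.
\<close>

locale normed_space_on =
  fixes V :: "'a::real_vector set" and N :: "'a \<Rightarrow> real"
  assumes subspace: "subspace V"
    and norm_eq_0: "x \<in> V \<Longrightarrow> N x = 0 \<longleftrightarrow> x = 0"
    and norm_triangle: "x \<in> V \<Longrightarrow> y \<in> V \<Longrightarrow> N (x + y) \<le> N x + N y"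
    and norm_scaleR: "x \<in> V \<Longrightarrow> N (c *\<^sub>R x) = \<bar>c\<bar> * N x"

locale banach_space_on = normed_space_on +
  assumes complete:
    "\<lbrakk>range \<sigma> \<subseteq> V; \<forall>e>0. \<exists>M. \<forall>m\<ge>M. \<forall>n\<ge>M. N (\<sigma> m - \<sigma> n) < e\<rbrakk>
      \<Longrightarrow> \<exists>l\<in>V. (\<lambda>n. N (\<sigma> n - l)) \<longlonglongrightarrow> 0"

text \<open>
  Functionals on \<open>V\<close> are extended by \<open>0\<close> outside \<open>V\<close>, so that each element of the dual has exactly
  one representative and the dual is again a linear subspace (of a function space).
\<close>

definition dual_space :: "'a::real_vector set \<Rightarrow> ('a \<Rightarrow> real) \<Rightarrow> ('a \<Rightarrow> real) set"
  where "dual_space V N = {\<phi>.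
    (\<forall>x\<in>V. \<forall>y\<in>V. \<phi> (x + y) = \<phi> x + \<phi> y) \<and>
    (\<forall>c. \<forall>x\<in>V. \<phi> (c *\<^sub>R x) = c * \<phi> x) \<and>
    (\<exists>B. \<forall>x\<in>V. \<bar>\<phi> x\<bar> \<le> B * N x) \<and>
    (\<forall>x. x \<notin> V \<longrightarrow> \<phi> x = 0)}"

definition dual_norm :: "'a::real_vector set \<Rightarrow> ('a \<Rightarrow> real) \<Rightarrow> ('a \<Rightarrow> real) \<Rightarrow> real"
  where "dual_norm V N \<phi> = (SUP x\<in>{x \<in> V. N x \<le> 1}. \<bar>\<phi> x\<bar>)"

text \<open>The canonical embedding into the bidual is onto.\<close>

definition reflexive_on :: "'a::real_vector set \<Rightarrow> ('a \<Rightarrow> real) \<Rightarrow> bool"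
  where "reflexive_on V N \<longleftrightarrow>
    (\<forall>\<Psi> \<in> dual_space (dual_space V N) (dual_norm V N).
      \<exists>y\<in>V. \<forall>\<phi>\<in>dual_space V N. \<Psi> \<phi> = \<phi> y)"

definition weak_topology :: "'a::real_vector set \<Rightarrow> ('a \<Rightarrow> real) \<Rightarrow> 'a topology"
  where "weak_topology V N =
    topology_generated_by {{x \<in> V. \<phi> x \<in> U} |\<phi> U. \<phi> \<in> dual_space V N \<and> open U}"

definition cwk :: "'a::real_vector set \<Rightarrow> ('a \<Rightarrow> real) \<Rightarrow> 'a set set"
  where "cwk V N = {K. K \<noteq> {} \<and> convex K \<and> compactin (weak_topology V N) K}"

text \<open>
  A real-valued supremum, meaningful for non-empty sets that are bounded with respect to \<open>N\<close>; it is
  only applied to weakly compact sets, which are bounded.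
\<close>

definition hausdorff_distance :: "('a::real_vector \<Rightarrow> real) \<Rightarrow> 'a set \<Rightarrow> 'a set \<Rightarrow> real"
  where "hausdorff_distance N A B =
    max (SUP a\<in>A. INF b\<in>B. N (a - b)) (SUP b\<in>B. INF a\<in>A. N (a - b))"


section \<open>Gauges and partitions of the unit interval\<close>

definition subintervals :: "real set set"
  where "subintervals = {{a..b} |a b. 0 \<le> a \<and> a < b \<and> b \<le> 1}"

definition gauge01 :: "(real \<Rightarrow> real) \<Rightarrow> bool"
  where "gauge01 \<delta> \<longleftrightarrow> (\<forall>t\<in>{0..1}. 0 < \<delta> t)"

text \<open>The tags are arbitrary points of the unit interval, not necessarily of their interval.\<close>

definition partition01 :: "(real set \<times> real) set \<Rightarrow> bool"
  where "partition01 P \<longleftrightarrow>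
    finite P \<and>
    (\<forall>(I, t)\<in>P. I \<in> subintervals \<and> t \<in> {0..1}) \<and>
    (\<forall>p\<in>P. \<forall>q\<in>P. p \<noteq> q \<longrightarrow> interior (fst p) \<inter> interior (fst q) = {}) \<and>
    (\<Union>(I, t)\<in>P. I) = {0..1}"

definition perron_partition01 :: "(real set \<times> real) set \<Rightarrow> bool"
  where "perron_partition01 P \<longleftrightarrow> partition01 P \<and> (\<forall>(I, t)\<in>P. t \<in> I)"

definition delta_fine :: "(real \<Rightarrow> real) \<Rightarrow> (real set \<times> real) set \<Rightarrow> bool"
  where "delta_fine \<delta> P \<longleftrightarrow> (\<forall>(I, t)\<in>P. I \<subseteq> {t - \<delta> t<..<t + \<delta> t})"


section \<open>Integrability and selections\<close>

text \<open>The sum of two sets is the Minkowski sum.\<close>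

definition finitely_additive :: "(real set \<Rightarrow> 'a::real_vector set) \<Rightarrow> bool"
  where "finitely_additive \<Phi> \<longleftrightarrow>
    (\<forall>I\<in>subintervals. \<forall>J\<in>subintervals.
      interior I \<inter> interior J = {} \<and> I \<union> J \<in> subintervals \<longrightarrow> \<Phi> (I \<union> J) = \<Phi> I + \<Phi> J)"

definition variationally_McShane_integrable ::
    "'a::real_vector set \<Rightarrow> ('a \<Rightarrow> real) \<Rightarrow> (real \<Rightarrow> 'a set) \<Rightarrow> bool"
  where "variationally_McShane_integrable V N \<Gamma> \<longleftrightarrow>
    (\<exists>\<Phi>. (\<forall>I\<in>subintervals. \<Phi> I \<in> cwk V N) \<and> finitely_additive \<Phi> \<and>
      (\<forall>\<epsilon>>0. \<exists>\<delta>. gauge01 \<delta> \<and>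
        (\<forall>P. partition01 P \<and> delta_fine \<delta> P \<longrightarrow>
          (\<Sum>(I, t)\<in>P. hausdorff_distance N (\<Phi> I) ((\<lambda>y. measure lborel I *\<^sub>R y) ` \<Gamma> t)) < \<epsilon>)))"

definition Henstock_integrable_on01 ::
    "'a::real_vector set \<Rightarrow> ('a \<Rightarrow> real) \<Rightarrow> (real \<Rightarrow> 'a) \<Rightarrow> bool"
  where "Henstock_integrable_on01 V N f \<longleftrightarrow>
    (\<exists>y\<in>V. \<forall>\<epsilon>>0. \<exists>\<delta>. gauge01 \<delta> \<and>
      (\<forall>P. perron_partition01 P \<and> delta_fine \<delta> P \<longrightarrow>
        N (y - (\<Sum>(I, t)\<in>P. measure lborel I *\<^sub>R f t)) < \<epsilon>))"

definition scalarly_measurable ::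
    "'a::real_vector set \<Rightarrow> ('a \<Rightarrow> real) \<Rightarrow> (real \<Rightarrow> 'a) \<Rightarrow> bool"
  where "scalarly_measurable V N f \<longleftrightarrow>
    (\<forall>\<phi>\<in>dual_space V N. (\<lambda>t. \<phi> (f t)) \<in> borel_measurable (lebesgue_on {0..1}))"

definition selection :: "(real \<Rightarrow> 'a set) \<Rightarrow> (real \<Rightarrow> 'a) \<Rightarrow> bool"
  where "selection \<Gamma> f \<longleftrightarrow> (\<forall>t\<in>{0..1}. f t \<in> \<Gamma> t)"

end

theory Submission
  imports Defs
begin

text \<open>
The multifunction is constant, equal to the closed unit ball of a reflexive space. A constant
multifunction with a convex value \<open>B\<close> is variationally McShane integrable for a trivial reason:
\<open>\<Phi>(I) = |I| B\<close> makes every Hausdorff distance vanish. Everything therefore rests on the space. It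
should contain vectors \<open>e\<^sub>t\<close>, \<open>t \<in> [0,1]\<close>, in its unit ball such that \<open>t \<mapsto> e\<^sub>t\<close> is scalarly null
(each functional vanishes on all but countably many \<open>e\<^sub>t\<close>), while for some \<open>\<theta> > 0\<close> every gauge has
a fine Perron partition whose Riemann sum has norm at least \<open>\<theta>\<close>.

\<^bold>\<open>The space.\<close> A function \<open>c\<close> from pairs of points to natural numbers defines \<^emph>\<open>blocks\<close>: the finite sets
\<open>F\<close> with \<open>|F| \<le> c s t\<close> for all distinct \<open>s, t \<in> F\<close>. The norm of \<open>x\<close> is the supremum, over finite
disjoint families of blocks, of the Euclidean norm of the vector of the \<open>\<ell>\<^sup>1\<close>-norms of \<open>x\<close> on
the blocks. This is Baernstein's modification of the Schreier space, with an arbitrary index set. On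
each block the norm dominates the \<open>\<ell>\<^sup>1\<close>-norm, and disjoint supports give a lower 2-estimate.

\<^bold>\<open>Reflexivity, for every c.\<close> The lower 2-estimate makes finitely supported vectors dense
(\<open>finite_support_approximation\<close>). The main step is that functionals are determined up to small norm
by finitely many coordinates (\<open>dual_shrinking\<close>). Otherwise a functional is at least \<open>\<epsilon>\<close> on infinitely
many disjointly supported vectors of norm at most 1, hence, after averaging, on vectors whose entries are as small
as desired. Adding such a flat vector \<open>u\<close> to \<open>z\<close> increases the squared norm by at most 2 more than
twice the Euclidean norm of \<open>z\<close> (\<open>baernstein_norm_add_flat_le\<close>): a block with two points in the support of
\<open>z\<close> has bounded size and so hardly sees \<open>u\<close>, and a block with at most one such point sees
\<open>z\<close> only through one coordinate. So a sum of \<open>n\<close> such vectors has norm of order \<open>n\<^sup>3\<^sup>/\<^sup>4\<close>, against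
the value \<open>n \<epsilon>\<close> of the functional. Given this, a bidual functional is evaluation at the vector of its
values on the coordinate functionals (\<open>baernstein_space_reflexive\<close>); balls are weakly compact since
the weak topology on them is coordinatewise convergence (\<open>baernstein_ball_cwk\<close>); and \<open>t \<mapsto> e\<^sub>t\<close> is
scalarly null (\<open>dual_unit_vector_countable\<close>).

\<^bold>\<open>The choice of c.\<close> There are uncountably many disjoint sets \<open>S l \<subseteq> [0,1]\<close>, with real labels \<open>l\<close>, of
outer measure greater than a fixed \<open>\<theta>\<close> (\<open>uncountable_disjoint_thick_family\<close>). Let \<open>c s t\<close> be the integer
part of \<open>1/|l - m|\<close> for \<open>s \<in> S l\<close>, \<open>t \<in> S m\<close>, \<open>l \<noteq> m\<close>. Given a gauge \<open>\<delta>\<close>, for each label \<open>l\<close> there is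
an \<open>n\<close> for which the points of \<open>S l\<close> with \<open>\<delta> > 1/n\<close> have outer measure greater than \<open>\<theta>\<close>, and one \<open>n\<close>
serves uncountably many labels. Infinitely many of these are within \<open>1/n\<close> of each other. Each of these point
sets meets at least \<open>\<theta> n\<close> of the \<open>n\<close> intervals of length \<open>1/n\<close>, so about \<open>\<theta> n\<close> labels can be
assigned different intervals; one tag from each is a block (\<open>block_in_every_gauge\<close>). The
corresponding intervals belong to a fine Perron partition, and on this block its Riemann sum has
\<open>\<ell>\<^sup>1\<close>-norm at least \<open>\<theta>\<close>. As the integral could only be \<open>0\<close>, this excludes Henstock integrability
(\<open>unit_vector_not_Henstock\<close>).
\<close>

section \<open>Baernstein norms over families of blocks\<close>

definition blocks :: "('a \<Rightarrow> 'a \<Rightarrow> nat) \<Rightarrow> 'a set set"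
  where "blocks c = {F. finite F \<and> (\<forall>s\<in>F. \<forall>t\<in>F. s \<noteq> t \<longrightarrow> card F \<le> c s t)}"

definition packings :: "('a \<Rightarrow> 'a \<Rightarrow> nat) \<Rightarrow> 'a set set set"
  where "packings c = {D. finite D \<and> D \<subseteq> blocks c \<and> disjoint D}"

definition packing_norm :: "'a set set \<Rightarrow> ('a \<Rightarrow> real) \<Rightarrow> real"
  where "packing_norm D x = L2_set (\<lambda>F. \<Sum>t\<in>F. \<bar>x t\<bar>) D"

definition baernstein_space :: "('a \<Rightarrow> 'a \<Rightarrow> nat) \<Rightarrow> ('a \<Rightarrow> real) set"
  where "baernstein_space c = {x. \<exists>M. \<forall>D\<in>packings c. packing_norm D x \<le> M}"

definition baernstein_norm :: "('a \<Rightarrow> 'a \<Rightarrow> nat) \<Rightarrow> ('a \<Rightarrow> real) \<Rightarrow> real"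
  where "baernstein_norm c x = (SUP D\<in>packings c. packing_norm D x)"

definition restriction :: "'a set \<Rightarrow> ('a \<Rightarrow> real) \<Rightarrow> 'a \<Rightarrow> real"
  where "restriction A x = (\<lambda>t. if t \<in> A then x t else 0)"

definition unit_vector :: "'a \<Rightarrow> 'a \<Rightarrow> real"
  where "unit_vector t = indicator {t}"

lemma minus_fun_apply [simp]: "(x - y) t = x t - y t" for x y :: "'a \<Rightarrow> real"
  by (simp add: fun_diff_def)

lemma block_finite: "F \<in> blocks c \<Longrightarrow> finite F"
  by (simp add: blocks_def)

lemma block_subset:
  assumes "F \<in> blocks c" "E \<subseteq> F" shows "E \<in> blocks c"
proof -
  have "finite F" using assms(1) by (simp add: blocks_def)
  then have "finite E" "card E \<le> card F"
    using assms(2) by (simp_all add: finite_subset card_mono)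
  moreover have "card F \<le> c s t" if "s \<in> E" "t \<in> E" "s \<noteq> t" for s t
    using assms that by (simp add: blocks_def subset_iff)
  ultimately show ?thesis
    by (simp add: blocks_def) (meson le_trans)
qed

lemma singleton_block: "{t} \<in> blocks c"
  by (simp add: blocks_def)

lemma empty_packing: "{} \<in> packings c"
  by (simp add: packings_def)

lemma packing_singleton: "F \<in> blocks c \<Longrightarrow> {F} \<in> packings c"
  by (simp add: packings_def)

lemma packing_singletons: "finite A \<Longrightarrow> (\<lambda>t. {t}) ` A \<in> packings c"
  by (auto simp: packings_def singleton_block disjoint_def)

lemma packing_finite: "D \<in> packings c \<Longrightarrow> finite D"
  by (simp add: packings_def)

lemma packing_block: "D \<in> packings c \<Longrightarrow> F \<in> D \<Longrightarrow> F \<in> blocks c"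
  by (auto simp: packings_def)

lemma packing_unique: "D \<in> packings c \<Longrightarrow> F \<in> D \<Longrightarrow> G \<in> D \<Longrightarrow> t \<in> F \<Longrightarrow> t \<in> G \<Longrightarrow> F = G"
  by (auto simp: packings_def disjoint_def)

lemma packing_Union_finite: "D \<in> packings c \<Longrightarrow> finite (\<Union>D)"
  using packing_finite [of D c] block_finite [OF packing_block [of D c]] by auto

lemma packing_norm_nonneg: "0 \<le> packing_norm D x"
  by (simp add: packing_norm_def)

lemma packing_norm_power2: "(packing_norm D x)\<^sup>2 = (\<Sum>F\<in>D. (\<Sum>t\<in>F. \<bar>x t\<bar>)\<^sup>2)"
  by (simp add: packing_norm_def L2_set_def sum_nonneg)

lemma packing_norm_triangle: "packing_norm D (x + y) \<le> packing_norm D x + packing_norm D y"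
proof -
  have "packing_norm D (x + y) \<le> L2_set (\<lambda>F. (\<Sum>t\<in>F. \<bar>x t\<bar>) + (\<Sum>t\<in>F. \<bar>y t\<bar>)) D"
    unfolding packing_norm_def sum.distrib [symmetric]
    by (intro L2_set_mono sum_mono) (auto simp: sum_nonneg)
  also have "\<dots> \<le> packing_norm D x + packing_norm D y"
    unfolding packing_norm_def by (rule L2_set_triangle_ineq)
  finally show ?thesis .
qed

lemma packing_norm_scaleR: "packing_norm D (a *\<^sub>R x) = \<bar>a\<bar> * packing_norm D x"
  by (simp add: packing_norm_def L2_set_right_distrib abs_mult sum_distrib_left)

lemma packing_norm_mono:
  assumes "\<And>t. \<bar>x t\<bar> \<le> \<bar>y t\<bar>" shows "packing_norm D x \<le> packing_norm D y"
  unfolding packing_norm_def by (intro L2_set_mono sum_mono) (auto simp: sum_nonneg assms)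

lemma packing_norm_le_norm:
  assumes "x \<in> baernstein_space c" "D \<in> packings c"
  shows "packing_norm D x \<le> baernstein_norm c x"
proof -
  have "bdd_above ((\<lambda>D. packing_norm D x) ` packings c)"
    using assms(1) by (auto simp: baernstein_space_def bdd_above_def)
  then show ?thesis
    unfolding baernstein_norm_def using assms(2) by (rule cSUP_upper2) simp
qed

lemma baernstein_norm_leI:
  assumes "\<And>D. D \<in> packings c \<Longrightarrow> packing_norm D x \<le> M"
  shows "x \<in> baernstein_space c" "baernstein_norm c x \<le> M"
proof -
  show "x \<in> baernstein_space c" using assms by (auto simp: baernstein_space_def)
  show "baernstein_norm c x \<le> M"
    unfolding baernstein_norm_def using assms empty_packing by (intro cSUP_least) auto
qed

lemma baernstein_norm_nonneg: "x \<in> baernstein_space c \<Longrightarrow> 0 \<le> baernstein_norm c x"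
  using packing_norm_le_norm [OF _ empty_packing] by (simp add: packing_norm_def)

lemma sum_block_le_norm:
  assumes "x \<in> baernstein_space c" "F \<in> blocks c"
  shows "(\<Sum>t\<in>F. \<bar>x t\<bar>) \<le> baernstein_norm c x"
  using packing_norm_le_norm [OF assms(1) packing_singleton [OF assms(2)]]
  by (simp add: packing_norm_def L2_set_def sum_nonneg)

lemma coordinate_le_norm: "x \<in> baernstein_space c \<Longrightarrow> \<bar>x t\<bar> \<le> baernstein_norm c x"
  using sum_block_le_norm [OF _ singleton_block, of x c t] by simp

lemma sum_squares_le_norm:
  assumes "x \<in> baernstein_space c" "finite A"
  shows "(\<Sum>t\<in>A. (x t)\<^sup>2) \<le> (baernstein_norm c x)\<^sup>2"
proof -
  have "(packing_norm ((\<lambda>t. {t}) ` A) x)\<^sup>2 = (\<Sum>t\<in>A. (x t)\<^sup>2)"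
    unfolding packing_norm_power2 by (subst sum.reindex) (auto simp: inj_on_def)
  moreover have "(packing_norm ((\<lambda>t. {t}) ` A) x)\<^sup>2 \<le> (baernstein_norm c x)\<^sup>2"
    by (intro power_mono packing_norm_le_norm packing_singletons packing_norm_nonneg assms)
  ultimately show ?thesis by simp
qed

lemma zero_in_space: "0 \<in> baernstein_space c"
  by (rule baernstein_norm_leI(1) [where M = 0]) (simp add: packing_norm_def L2_set_def)

lemma
  assumes "x \<in> baernstein_space c" "y \<in> baernstein_space c"
  shows add_in_space: "x + y \<in> baernstein_space c"
    and baernstein_norm_add_le: "baernstein_norm c (x + y) \<le> baernstein_norm c x + baernstein_norm c y"
proof -
  have "packing_norm D (x + y) \<le> baernstein_norm c x + baernstein_norm c y"
    if "D \<in> packings c" for D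
    using packing_norm_triangle [of D x y] packing_norm_le_norm [OF assms(1) that]
      packing_norm_le_norm [OF assms(2) that] by linarith
  then show "x + y \<in> baernstein_space c"
      "baernstein_norm c (x + y) \<le> baernstein_norm c x + baernstein_norm c y"
    using baernstein_norm_leI by blast+
qed

lemma scaleR_in_space:
  assumes "x \<in> baernstein_space c" shows "a *\<^sub>R x \<in> baernstein_space c"
  by (rule baernstein_norm_leI(1) [where M = "\<bar>a\<bar> * baernstein_norm c x"])
    (simp add: packing_norm_scaleR mult_left_mono packing_norm_le_norm assms)

lemma baernstein_norm_scaleR:
  assumes "x \<in> baernstein_space c"
  shows "baernstein_norm c (a *\<^sub>R x) = \<bar>a\<bar> * baernstein_norm c x"
proof -
  have le: "baernstein_norm c (b *\<^sub>R y) \<le> \<bar>b\<bar> * baernstein_norm c y"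
    if "y \<in> baernstein_space c" for b y
    by (rule baernstein_norm_leI(2)) (simp add: packing_norm_scaleR mult_left_mono packing_norm_le_norm that)
  show ?thesis
  proof (cases "a = 0")
    case True
    then show ?thesis
      using le [OF assms, of a] baernstein_norm_nonneg [OF zero_in_space, of c] by simp
  next
    case False
    have "baernstein_norm c x = baernstein_norm c (inverse a *\<^sub>R (a *\<^sub>R x))"
      using False by simp
    also have "\<dots> \<le> inverse \<bar>a\<bar> * baernstein_norm c (a *\<^sub>R x)"
      using le [OF scaleR_in_space [OF assms], of "inverse a" a] by simp
    finally have "\<bar>a\<bar> * baernstein_norm c x \<le> baernstein_norm c (a *\<^sub>R x)"
      using False by (simp add: field_simps)
    then show ?thesis using le [OF assms, of a] by simp
  qed
qed

lemma diff_in_space: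
  "x \<in> baernstein_space c \<Longrightarrow> y \<in> baernstein_space c \<Longrightarrow> x - y \<in> baernstein_space c"
  using add_in_space [of x c "(-1) *\<^sub>R y"] scaleR_in_space [of y c "-1"] by simp

lemma
  assumes "y \<in> baernstein_space c" "\<And>t. \<bar>x t\<bar> \<le> \<bar>y t\<bar>"
  shows solid_in_space: "x \<in> baernstein_space c"
    and baernstein_norm_mono: "baernstein_norm c x \<le> baernstein_norm c y"
proof -
  have "packing_norm D x \<le> baernstein_norm c y" if "D \<in> packings c" for D
    using packing_norm_mono [of x y D, OF assms(2)] packing_norm_le_norm [OF assms(1) that]
    by linarith
  then show "x \<in> baernstein_space c" "baernstein_norm c x \<le> baernstein_norm c y"
    using baernstein_norm_leI by blast+
qed

lemma restriction_in_space:
  "x \<in> baernstein_space c \<Longrightarrow> restriction A x \<in> baernstein_space c"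
  by (erule solid_in_space) (simp add: restriction_def)

lemma
  shows unit_vector_in_space: "unit_vector t \<in> baernstein_space c"
    and baernstein_norm_unit_vector_le: "baernstein_norm c (unit_vector t) \<le> 1"
proof -
  have "packing_norm D (unit_vector t) \<le> 1" if D: "D \<in> packings c" for D
  proof -
    have F: "(\<Sum>s\<in>F. \<bar>unit_vector t s\<bar>) = (if t \<in> F then 1 else 0)" if "F \<in> D" for F
      using block_finite [OF packing_block [OF D that]]
      by (auto simp: unit_vector_def indicator_def of_bool_def if_distrib cong: if_cong)
    have "card {F \<in> D. t \<in> F} \<le> 1"
    proof (rule ccontr)
      assume "\<not> card {F \<in> D. t \<in> F} \<le> 1"
      then obtain F G where "F \<in> D" "G \<in> D" "t \<in> F" "t \<in> G" "F \<noteq> G"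
        using card_le_Suc0_iff_eq [of "{F \<in> D. t \<in> F}"] packing_finite [OF D] by auto
      then show False using D by (auto simp: packings_def disjoint_def)
    qed
    moreover have "(packing_norm D (unit_vector t))\<^sup>2 = real (card {F \<in> D. t \<in> F})"
      unfolding packing_norm_power2
      using packing_finite [OF D]
      by (simp add: F if_distrib [of "\<lambda>a. a\<^sup>2"] sum.If_cases Int_def cong: if_cong)
    ultimately have "(packing_norm D (unit_vector t))\<^sup>2 \<le> 1\<^sup>2" by simp
    then show ?thesis by (rule power2_le_imp_le) simp
  qed
  then show "unit_vector t \<in> baernstein_space c" "baernstein_norm c (unit_vector t) \<le> 1"
    using baernstein_norm_leI by blast+
qed

lemma finite_support_in_space:
  assumes "finite A" "\<And>t. t \<notin> A \<Longrightarrow> x t = 0"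
  shows "x \<in> baernstein_space c"
  using assms
proof (induction A arbitrary: x rule: finite_induct)
  case empty
  then have "x = 0" by (auto simp: fun_eq_iff)
  then show ?case using zero_in_space by metis
next
  case (insert s A)
  have "x = restriction A x + x s *\<^sub>R unit_vector s"
    using insert by (auto simp: fun_eq_iff restriction_def unit_vector_def indicator_def)
  moreover have "restriction A x \<in> baernstein_space c"
    by (rule insert.IH) (simp add: restriction_def)
  ultimately show ?case
    using add_in_space scaleR_in_space unit_vector_in_space by metis
qed

lemma baernstein_space_banach: "banach_space_on (baernstein_space c) (baernstein_norm c)"
proof
  show "subspace (baernstein_space c)"
    by (auto simp: subspace_def zero_in_space add_in_space scaleR_in_space)
  show "baernstein_norm c x = 0 \<longleftrightarrow> x = 0" if "x \<in> baernstein_space c" for x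
  proof
    assume "baernstein_norm c x = 0"
    then show "x = 0" using coordinate_le_norm [OF that] by (simp add: fun_eq_iff)
  next
    assume "x = 0"
    then show "baernstein_norm c x = 0" using baernstein_norm_scaleR [OF that, of 0] by simp
  qed
  fix \<sigma> :: "nat \<Rightarrow> 'a \<Rightarrow> real"
  assume range: "range \<sigma> \<subseteq> baernstein_space c"
    and cauchy: "\<forall>e>0. \<exists>M. \<forall>m\<ge>M. \<forall>n\<ge>M. baernstein_norm c (\<sigma> m - \<sigma> n) < e"
  have \<sigma>: "\<sigma> n \<in> baernstein_space c" for n using range by auto
  have "Cauchy (\<lambda>n. \<sigma> n t)" for t
  proof (rule metric_CauchyI)
    fix e :: real assume "e > 0"
    then obtain M where M: "\<forall>m\<ge>M. \<forall>n\<ge>M. baernstein_norm c (\<sigma> m - \<sigma> n) < e"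
      using cauchy by meson
    have "dist (\<sigma> m t) (\<sigma> n t) < e" if "m \<ge> M" "n \<ge> M" for m n
    proof -
      have "dist (\<sigma> m t) (\<sigma> n t) \<le> baernstein_norm c (\<sigma> m - \<sigma> n)"
        using coordinate_le_norm [OF diff_in_space [OF \<sigma> \<sigma>], of m n t]
        by (simp add: dist_real_def)
      then show ?thesis using M that by (meson le_less_trans)
    qed
    then show "\<exists>M. \<forall>m\<ge>M. \<forall>n\<ge>M. dist (\<sigma> m t) (\<sigma> n t) < e" by blast
  qed
  define l where "l = (\<lambda>t. lim (\<lambda>n. \<sigma> n t))"
  have l: "(\<lambda>n. \<sigma> n t) \<longlonglongrightarrow> l t" for t
    using real_Cauchy_convergent [OF \<open>\<And>t. Cauchy (\<lambda>n. \<sigma> n t)\<close>]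
    by (simp add: l_def convergent_LIMSEQ_iff)
  have tail: "\<exists>M. \<forall>n\<ge>M. \<sigma> n - l \<in> baernstein_space c \<and> baernstein_norm c (\<sigma> n - l) \<le> e"
    if e: "e > 0" for e
  proof -
    obtain M where M: "\<forall>m\<ge>M. \<forall>n\<ge>M. baernstein_norm c (\<sigma> m - \<sigma> n) < e"
      using cauchy e by meson
    have "packing_norm D (\<sigma> n - l) \<le> e" if "n \<ge> M" "D \<in> packings c" for n D
    proof (rule LIMSEQ_le_const2)
      show "(\<lambda>m. packing_norm D (\<sigma> n - \<sigma> m)) \<longlonglongrightarrow> packing_norm D (\<sigma> n - l)"
        unfolding packing_norm_def L2_set_def minus_fun_apply by (intro tendsto_intros l)
      have "packing_norm D (\<sigma> n - \<sigma> m) \<le> e" if "m \<ge> M" for m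
        using packing_norm_le_norm [OF diff_in_space [OF \<sigma> \<sigma>] \<open>D \<in> packings c\<close>, of n m]
          M [rule_format, OF \<open>n \<ge> M\<close> that] by linarith
      then show "\<exists>M. \<forall>m\<ge>M. packing_norm D (\<sigma> n - \<sigma> m) \<le> e" by blast
    qed
    then show ?thesis using baernstein_norm_leI by blast
  qed
  obtain M where "\<sigma> M - l \<in> baernstein_space c" using tail [of 1] by auto
  then have "l \<in> baernstein_space c" using diff_in_space [OF \<sigma> [of M]] by force
  moreover have "(\<lambda>n. baernstein_norm c (\<sigma> n - l)) \<longlonglongrightarrow> 0"
  proof (rule LIMSEQ_I)
    fix r :: real assume "r > 0"
    then obtain M where "\<forall>n\<ge>M. \<sigma> n - l \<in> baernstein_space c \<and> baernstein_norm c (\<sigma> n - l) \<le> r / 2"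
      using tail [of "r / 2"] by auto
    then have "norm (baernstein_norm c (\<sigma> n - l) - 0) < r" if "n \<ge> M" for n
      using baernstein_norm_nonneg [of "\<sigma> n - l" c] \<open>r > 0\<close> that by auto
    then show "\<exists>M. \<forall>n\<ge>M. norm (baernstein_norm c (\<sigma> n - l) - 0) < r" by blast
  qed
  ultimately show "\<exists>l\<in>baernstein_space c. (\<lambda>n. baernstein_norm c (\<sigma> n - l)) \<longlonglongrightarrow> 0" by blast
qed (auto intro: baernstein_norm_add_le baernstein_norm_scaleR)

text \<open>
A packing that almost attains the norm of \<open>x\<close> carries almost all of it: any packing of the part of
\<open>x\<close> outside can be added to it, and squares of norms then add up.
\<close>

lemma finite_support_approximation:
  assumes x: "x \<in> baernstein_space c" and "0 < e"
  obtains A where "finite A" "baernstein_norm c (x - restriction A x) \<le> e"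
proof -
  let ?N = "baernstein_norm c x"
  have "\<exists>D\<in>packings c. ?N\<^sup>2 - e\<^sup>2 < (packing_norm D x)\<^sup>2"
  proof (rule ccontr)
    assume "\<not> ?thesis"
    then have *: "(packing_norm D x)\<^sup>2 \<le> ?N\<^sup>2 - e\<^sup>2" if "D \<in> packings c" for D
      using that by force
    have "?N \<le> sqrt (?N\<^sup>2 - e\<^sup>2)"
      by (rule baernstein_norm_leI(2)) (use * in \<open>auto intro: real_le_rsqrt\<close>)
    moreover have "sqrt (?N\<^sup>2 - e\<^sup>2) < sqrt (?N\<^sup>2)"
      using \<open>0 < e\<close> by (intro real_sqrt_less_mono) simp
    ultimately show False using baernstein_norm_nonneg [OF x] by simp
  qed
  then obtain D where D: "D \<in> packings c" "?N\<^sup>2 - e\<^sup>2 < (packing_norm D x)\<^sup>2" by blast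
  define A where "A = \<Union>D"
  have "packing_norm E (x - restriction A x) \<le> e" if E: "E \<in> packings c" for E
  proof (rule power2_le_imp_le)
    define E' where "E' = (\<lambda>F. F - A) ` E"
    have "D \<union> E' \<in> packings c"
    proof -
      have "finite (D \<union> E')"
        using packing_finite [OF D(1)] packing_finite [OF E] by (simp add: E'_def)
      moreover have "D \<union> E' \<subseteq> blocks c"
        using packing_block [OF D(1)] packing_block [OF E] by (auto simp: E'_def intro: block_subset)
      moreover have "F = G" if "F \<in> D \<union> E'" "G \<in> D \<union> E'" "t \<in> F" "t \<in> G" for F G t
      proof (cases "t \<in> A")
        case True
        then show ?thesis using that packing_unique [OF D(1)] unfolding E'_def by blast
      next
        case False
        then have "F \<in> E'" "G \<in> E'" using that by (auto simp: A_def)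
        then show ?thesis using that packing_unique [OF E] unfolding E'_def by blast
      qed
      ultimately show ?thesis unfolding packings_def disjoint_def by blast
    qed
    then have "(packing_norm (D \<union> E') x)\<^sup>2 \<le> ?N\<^sup>2"
      by (intro power_mono packing_norm_le_norm packing_norm_nonneg x)
    moreover have "(packing_norm (D \<union> E') x)\<^sup>2 = (packing_norm D x)\<^sup>2 + (packing_norm E' x)\<^sup>2"
      unfolding packing_norm_power2
      using packing_finite [OF D(1)] packing_finite [OF E]
      by (intro sum.union_inter_neutral) (auto simp: E'_def A_def intro!: sum.neutral)
    moreover have "(packing_norm E' x)\<^sup>2 = (packing_norm E (x - restriction A x))\<^sup>2"
    proof -
      \<comment> \<open>Disjoint blocks that become equal after removing \<open>A\<close> have become empty.\<close>
      have "(packing_norm E' x)\<^sup>2 = (\<Sum>F\<in>E. (\<Sum>t\<in>F - A. \<bar>x t\<bar>)\<^sup>2)"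
        unfolding packing_norm_power2 E'_def
      proof (subst sum.reindex_nontrivial)
        fix F G assume "F \<in> E" "G \<in> E" "F \<noteq> G" "F - A = G - A"
        moreover have "F \<inter> G = {}"
          using E \<open>F \<in> E\<close> \<open>G \<in> E\<close> \<open>F \<noteq> G\<close> by (auto simp: packings_def disjoint_def)
        ultimately have "F - A = {}" by blast
        then show "(\<Sum>t\<in>F - A. \<bar>x t\<bar>)\<^sup>2 = 0" by (metis power_zero_numeral sum.empty)
      qed (auto simp: packing_finite [OF E])
      also have "\<dots> = (packing_norm E (x - restriction A x))\<^sup>2"
        unfolding packing_norm_power2
        using block_finite [OF packing_block [OF E]]
        by (intro sum.cong refl arg_cong [where f = "\<lambda>a. a\<^sup>2"] sum.mono_neutral_cong_left)
          (auto simp: restriction_def)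
      finally show ?thesis .
    qed
    ultimately show "(packing_norm E (x - restriction A x))\<^sup>2 \<le> e\<^sup>2"
      using D(2) by linarith
  qed (use \<open>0 < e\<close> in simp)
  moreover have "finite A" unfolding A_def by (rule packing_Union_finite [OF D(1)])
  ultimately show ?thesis using that baernstein_norm_leI(2) by blast
qed

section \<open>Functionals depend on few coordinates\<close>

lemma sum_packing_le:
  assumes D: "D \<in> packings c" and S: "finite S" and g: "\<And>t. 0 \<le> g t"
  shows "(\<Sum>F\<in>D. \<Sum>t\<in>F \<inter> S. g t) \<le> (\<Sum>t\<in>S. g t :: real)"
proof -
  have "(\<Sum>F\<in>D. \<Sum>t\<in>F \<inter> S. g t) = (\<Sum>t\<in>(\<Union>F\<in>D. F \<inter> S). g t)"
  proof (rule sum.UNION_disjoint [symmetric])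
    show "\<forall>F\<in>D. \<forall>G\<in>D. F \<noteq> G \<longrightarrow> (F \<inter> S) \<inter> (G \<inter> S) = {}"
      using packing_unique [OF D] by blast
  qed (use S packing_finite [OF D] in auto)
  also have "\<dots> \<le> (\<Sum>t\<in>S. g t)"
    using S g by (intro sum_mono2) auto
  finally show ?thesis .
qed

text \<open>
In the expansion of squares, \<open>(a F + b F)\<^sup>2\<close> exceeds the sum of the
squares by twice the product \<open>a F * b F\<close> of the contributions of \<open>z\<close> and \<open>u\<close> to a block. A block with two
points in \<open>S\<close> has at most \<open>M\<close> elements, so its \<open>b F\<close> is at most \<open>M * \<eta>\<close>; for the other blocks
\<open>a F\<close> involves at most one coordinate of \<open>z\<close>, and the Cauchy-Schwarz inequality applies.
\<close>

lemma baernstein_norm_add_flat_le: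
  fixes c :: "'a \<Rightarrow> 'a \<Rightarrow> nat"
  assumes S: "finite S" and z: "\<And>t. t \<notin> S \<Longrightarrow> z t = 0"
  obtains \<eta> where "0 < \<eta>"
    "\<And>u. \<lbrakk>u \<in> baernstein_space c; baernstein_norm c u \<le> 1; \<And>t. t \<in> S \<Longrightarrow> u t = 0; \<And>t. \<bar>u t\<bar> \<le> \<eta>\<rbrakk>
      \<Longrightarrow> (baernstein_norm c (z + u))\<^sup>2 \<le> (baernstein_norm c z)\<^sup>2 + 2 * sqrt (\<Sum>t\<in>S. (z t)\<^sup>2) + 2"
proof
  define M where "M = (\<Sum>s\<in>S. \<Sum>t\<in>S. c s t)"
  define Z where "Z = (\<Sum>t\<in>S. \<bar>z t\<bar>)"
  \<comment> \<open>With this \<open>\<eta>\<close>, the blocks that meet \<open>S\<close> twice contribute at most \<open>Z * M * \<eta> \<le> 1 / 2\<close>.\<close>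
  define \<eta> where "\<eta> = 1 / (2 * (Z * M + 1))"
  have "0 \<le> Z" by (simp add: Z_def sum_nonneg)
  then have pos: "0 < 2 * (Z * M + 1)" by (simp add: add_nonneg_pos)
  then show "0 < \<eta>" by (simp add: \<eta>_def)
  have ZM\<eta>: "Z * (M * \<eta>) \<le> 1 / 2"
    using pos unfolding \<eta>_def by (simp add: field_simps)
  have zV: "z \<in> baernstein_space c" by (rule finite_support_in_space [OF S z])
  fix u
  assume u: "u \<in> baernstein_space c" "baernstein_norm c u \<le> 1" "\<And>t. t \<in> S \<Longrightarrow> u t = 0"
    and u_le: "\<And>t. \<bar>u t\<bar> \<le> \<eta>"
  let ?B = "(baernstein_norm c z)\<^sup>2 + 2 * sqrt (\<Sum>t\<in>S. (z t)\<^sup>2) + 2"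
  have "(packing_norm D (z + u))\<^sup>2 \<le> ?B" if D: "D \<in> packings c" for D
  proof -
    define a where "a = (\<lambda>F. \<Sum>t\<in>F. \<bar>z t\<bar>)"
    define b where "b = (\<lambda>F. \<Sum>t\<in>F. \<bar>u t\<bar>)"
    have ab_nonneg: "0 \<le> a F" "0 \<le> b F" for F by (auto simp: a_def b_def sum_nonneg)
    have fin: "finite F" if "F \<in> D" for F
      using block_finite [OF packing_block [OF D that]] .
    have a_eq: "a F = (\<Sum>t\<in>F \<inter> S. \<bar>z t\<bar>)" if "F \<in> D" for F
      unfolding a_def using fin [OF that] z by (intro sum.mono_neutral_right) auto
    have a2: "(\<Sum>F\<in>D. (a F)\<^sup>2) \<le> (baernstein_norm c z)\<^sup>2"
      using power_mono [OF packing_norm_le_norm [OF zV D] packing_norm_nonneg, of 2]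
      by (simp add: packing_norm_power2 a_def)
    have "(packing_norm D u)\<^sup>2 \<le> 1"
      using packing_norm_le_norm [OF u(1) D] u(2) packing_norm_nonneg [of D u]
      by (simp add: power_le_one)
    then have b2: "(\<Sum>F\<in>D. (b F)\<^sup>2) \<le> 1"
      by (simp add: packing_norm_power2 b_def)
    define D1 where "D1 = {F \<in> D. \<exists>s\<in>F \<inter> S. \<exists>t\<in>F \<inter> S. s \<noteq> t}"
    have finD: "finite D" "finite D1" "finite (D - D1)" "D1 \<subseteq> D"
      using packing_finite [OF D] by (auto simp: D1_def)
    have "(\<Sum>F\<in>D1. a F * b F) \<le> (\<Sum>F\<in>D1. a F * (M * \<eta>))"
    proof (intro sum_mono mult_left_mono ab_nonneg)
      fix F assume "F \<in> D1"
      then obtain s t where st: "s \<in> F" "t \<in> F" "s \<in> S" "t \<in> S" "s \<noteq> t" and F: "F \<in> D"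
        by (auto simp: D1_def)
      have "card F \<le> c s t"
        using packing_block [OF D F] st by (auto simp: blocks_def)
      also have "\<dots> \<le> (\<Sum>t\<in>S. c s t)" using st S by (intro member_le_sum) auto
      also have "\<dots> \<le> M" unfolding M_def using st S by (intro member_le_sum) auto
      finally have "card F \<le> M" .
      have "b F \<le> card F * \<eta>" unfolding b_def using u_le by (intro sum_bounded_above)
      also have "\<dots> \<le> M * \<eta>" using \<open>card F \<le> M\<close> \<open>0 < \<eta>\<close> by simp
      finally show "b F \<le> M * \<eta>" .
    qed
    also have "\<dots> = (\<Sum>F\<in>D1. a F) * (M * \<eta>)" by (simp add: sum_distrib_right)
    also have "\<dots> \<le> Z * (M * \<eta>)"
    proof (rule mult_right_mono)
      have "(\<Sum>F\<in>D1. a F) \<le> (\<Sum>F\<in>D. a F)"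
        using finD ab_nonneg by (intro sum_mono2) auto
      also have "\<dots> = (\<Sum>F\<in>D. \<Sum>t\<in>F \<inter> S. \<bar>z t\<bar>)" by (simp add: a_eq)
      also have "\<dots> \<le> Z" unfolding Z_def by (rule sum_packing_le [OF D S]) simp
      finally show "(\<Sum>F\<in>D1. a F) \<le> Z" .
    qed (use \<open>0 < \<eta>\<close> in simp)
    finally have 1: "(\<Sum>F\<in>D1. a F * b F) \<le> 1 / 2" using ZM\<eta> by linarith
    have "(\<Sum>F\<in>D - D1. a F * b F) \<le> L2_set a (D - D1) * L2_set b (D - D1)"
      using L2_set_mult_ineq [of a b "D - D1"] by (simp add: ab_nonneg)
    also have "\<dots> \<le> sqrt (\<Sum>t\<in>S. (z t)\<^sup>2) * 1"
    proof (rule mult_mono)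
      have "(\<Sum>F\<in>D - D1. (a F)\<^sup>2) = (\<Sum>F\<in>D - D1. \<Sum>t\<in>F \<inter> S. (z t)\<^sup>2)"
      proof (rule sum.cong [OF refl])
        fix F assume F: "F \<in> D - D1"
        then have *: "s = t" if "s \<in> F \<inter> S" "t \<in> F \<inter> S" for s t
          using that by (auto simp: D1_def)
        have "F \<inter> S = {} \<or> (\<exists>t. F \<inter> S = {t})"
        proof (cases "F \<inter> S = {}")
          case False
          then obtain t where "t \<in> F \<inter> S" by blast
          then have "F \<inter> S = {t}" using * by blast
          then show ?thesis by blast
        qed simp
        moreover have "a F = (\<Sum>t\<in>F \<inter> S. \<bar>z t\<bar>)" using a_eq F by simp
        ultimately show "(a F)\<^sup>2 = (\<Sum>t\<in>F \<inter> S. (z t)\<^sup>2)" by auto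
      qed
      also have "\<dots> \<le> (\<Sum>F\<in>D. \<Sum>t\<in>F \<inter> S. (z t)\<^sup>2)"
        using finD by (intro sum_mono2) (auto simp: sum_nonneg)
      also have "\<dots> \<le> (\<Sum>t\<in>S. (z t)\<^sup>2)" by (rule sum_packing_le [OF D S]) simp
      finally show "L2_set a (D - D1) \<le> sqrt (\<Sum>t\<in>S. (z t)\<^sup>2)"
        by (simp add: L2_set_def)
      have "(\<Sum>F\<in>D - D1. (b F)\<^sup>2) \<le> (\<Sum>F\<in>D. (b F)\<^sup>2)"
        using finD by (intro sum_mono2) auto
      then show "L2_set b (D - D1) \<le> 1" using b2 by (simp add: L2_set_def)
    qed (auto simp: sum_nonneg)
    finally have 2: "(\<Sum>F\<in>D - D1. a F * b F) \<le> sqrt (\<Sum>t\<in>S. (z t)\<^sup>2)" by simp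
    have 3: "(\<Sum>F\<in>D. a F * b F) = (\<Sum>F\<in>D - D1. a F * b F) + (\<Sum>F\<in>D1. a F * b F)"
      using finD by (intro sum.subset_diff) auto
    have "(packing_norm D (z + u))\<^sup>2 \<le> (\<Sum>F\<in>D. (a F + b F)\<^sup>2)"
      unfolding packing_norm_power2 a_def b_def sum.distrib [symmetric]
      by (intro sum_mono power_mono) (auto simp: sum_nonneg)
    also have "\<dots> = (\<Sum>F\<in>D. (a F)\<^sup>2) + (\<Sum>F\<in>D. (b F)\<^sup>2) + 2 * (\<Sum>F\<in>D. a F * b F)"
      by (simp add: power2_sum sum.distrib sum_distrib_left mult.assoc)
    finally show ?thesis using a2 b2 1 2 3 by linarith
  qed
  then have "packing_norm D (z + u) \<le> sqrt ?B" if "D \<in> packings c" for D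
    using that by (intro real_le_rsqrt) auto
  then have "baernstein_norm c (z + u) \<le> sqrt ?B" by (rule baernstein_norm_leI(2))
  moreover have "0 \<le> baernstein_norm c (z + u)"
    by (intro baernstein_norm_nonneg add_in_space zV u)
  ultimately have "(baernstein_norm c (z + u))\<^sup>2 \<le> (sqrt ?B)\<^sup>2" by (intro power_mono)
  then show "(baernstein_norm c (z + u))\<^sup>2 \<le> ?B"
    by (simp add: sum_nonneg)
qed

abbreviation baernstein_dual :: "('a \<Rightarrow> 'a \<Rightarrow> nat) \<Rightarrow> (('a \<Rightarrow> real) \<Rightarrow> real) set"
  where "baernstein_dual c \<equiv> dual_space (baernstein_space c) (baernstein_norm c)"

lemma
  assumes "\<phi> \<in> baernstein_dual c" "x \<in> baernstein_space c"
  shows dual_add: "y \<in> baernstein_space c \<Longrightarrow> \<phi> (x + y) = \<phi> x + \<phi> y"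
    and dual_scaleR: "\<phi> (a *\<^sub>R x) = a * \<phi> x"
    and dual_diff: "y \<in> baernstein_space c \<Longrightarrow> \<phi> (x - y) = \<phi> x - \<phi> y"
proof -
  show add: "\<phi> (x + y) = \<phi> x + \<phi> y" if "y \<in> baernstein_space c" for y
    using assms that by (simp add: dual_space_def)
  show "\<phi> (a *\<^sub>R x) = a * \<phi> x" using assms by (simp add: dual_space_def)
  show "\<phi> (x - y) = \<phi> x - \<phi> y" if "y \<in> baernstein_space c"
  proof -
    have "\<phi> (-1 *\<^sub>R y) = -1 * \<phi> y" using assms that unfolding dual_space_def by blast
    then show ?thesis using add [OF scaleR_in_space [OF that, of "-1"]] by simp
  qed
qed

lemma dual_bounded:
  assumes "\<phi> \<in> baernstein_dual c"
  obtains C where "0 < C" "\<And>x. x \<in> baernstein_space c \<Longrightarrow> \<bar>\<phi> x\<bar> \<le> C * baernstein_norm c x"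
proof -
  obtain B where B: "\<forall>x\<in>baernstein_space c. \<bar>\<phi> x\<bar> \<le> B * baernstein_norm c x"
    using assms by (auto simp: dual_space_def)
  have "\<bar>\<phi> x\<bar> \<le> (\<bar>B\<bar> + 1) * baernstein_norm c x" if "x \<in> baernstein_space c" for x
  proof -
    have "B * baernstein_norm c x \<le> (\<bar>B\<bar> + 1) * baernstein_norm c x"
      using baernstein_norm_nonneg [OF that] by (intro mult_right_mono) auto
    then show ?thesis using B that by force
  qed
  then show ?thesis using that [of "\<bar>B\<bar> + 1"] by simp
qed

text \<open>
The coordinate projections converge in the dual norm, for otherwise there are vectors \<open>u\<close> far out
with \<open>\<phi> u \<ge> \<epsilon>\<close> (\<open>bump\<close>), sums of \<open>n\<close> of them with entries at most 1 (\<open>many\<close>), hence such vectors with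
arbitrarily small entries (\<open>flat\<close>). Adding \<open>m\<^sup>2\<close> flat ones successively (\<open>chain\<close>) keeps the Euclidean
norm below \<open>m\<close> and so the squared norm below \<open>m\<^sup>2 (2 m + 2)\<close>, while \<open>\<phi>\<close> reaches \<open>m\<^sup>2 \<epsilon>\<close>; this is
impossible for large \<open>m\<close>.
\<close>

lemma dual_shrinking:
  assumes \<phi>: "\<phi> \<in> baernstein_dual c" and "0 < \<epsilon>"
  shows "\<exists>A. finite A \<and> (\<forall>x\<in>baernstein_space c.
    \<bar>\<phi> x - \<phi> (restriction A x)\<bar> \<le> \<epsilon> * baernstein_norm c x)"
proof (rule ccontr)
  assume neg: "\<not> ?thesis"
  have no: "\<exists>x\<in>baernstein_space c. \<epsilon> * baernstein_norm c x < \<bar>\<phi> x - \<phi> (restriction A x)\<bar>"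
    if "finite A" for A
    using that neg by (meson not_le)
  obtain C where C: "0 < C" "\<And>x. x \<in> baernstein_space c \<Longrightarrow> \<bar>\<phi> x\<bar> \<le> C * baernstein_norm c x"
    using dual_bounded [OF \<phi>] by blast
  have bump: "\<exists>u E. finite E \<and> E \<inter> A = {} \<and> (\<forall>t. t \<notin> E \<longrightarrow> u t = 0) \<and>
      baernstein_norm c u \<le> 1 \<and> \<epsilon> \<le> \<phi> u" if A: "finite A" for A
  proof -
    obtain x where x: "x \<in> baernstein_space c"
      and *: "\<epsilon> * baernstein_norm c x < \<bar>\<phi> x - \<phi> (restriction A x)\<bar>" using no [OF A] by blast
    define v where "v = x - restriction A x"
    have rA: "restriction A x \<in> baernstein_space c" by (rule restriction_in_space [OF x])
    have v: "v \<in> baernstein_space c" unfolding v_def by (rule diff_in_space [OF x rA])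
    have \<phi>v: "\<phi> v = \<phi> x - \<phi> (restriction A x)" unfolding v_def by (rule dual_diff [OF \<phi> x rA])
    have vx: "\<bar>v t\<bar> \<le> \<bar>x t\<bar>" for t by (simp add: v_def restriction_def)
    \<comment> \<open>Replacing \<open>v\<close> by a vector at distance \<open>r\<close> changes \<open>\<phi> v\<close> by at most the slack in the inequality above.\<close>
    define r where "r = (\<bar>\<phi> v\<bar> - \<epsilon> * baernstein_norm c x) / C"
    have "0 < r" using * C by (simp add: r_def \<phi>v)
    then obtain E where E: "finite E" "baernstein_norm c (v - restriction E v) \<le> r"
      using finite_support_approximation [OF v] by blast
    define w where "w = restriction E v"
    have w: "w \<in> baernstein_space c" unfolding w_def by (rule restriction_in_space [OF v])
    have "\<bar>\<phi> (v - w)\<bar> \<le> C * baernstein_norm c (v - w)" by (intro C diff_in_space v w)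
    also have "\<dots> \<le> C * r" using E C by (simp add: w_def)
    finally have "\<bar>\<phi> v - \<phi> w\<bar> \<le> \<bar>\<phi> v\<bar> - \<epsilon> * baernstein_norm c x"
      using C by (simp add: r_def dual_diff [OF \<phi> v w])
    then have \<phi>w: "\<epsilon> * baernstein_norm c x \<le> \<bar>\<phi> w\<bar>" by linarith
    have wx: "baernstein_norm c w \<le> baernstein_norm c x"
      by (rule baernstein_norm_mono [OF x]) (use vx in \<open>auto simp: w_def restriction_def\<close>)
    have N0: "0 < baernstein_norm c x"
    proof (rule ccontr)
      assume "\<not> ?thesis"
      then have "baernstein_norm c x = 0" using baernstein_norm_nonneg [OF x] by linarith
      moreover have "baernstein_norm c v \<le> baernstein_norm c x" by (rule baernstein_norm_mono [OF x vx])
      ultimately have "\<bar>\<phi> v\<bar> \<le> 0"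
        using C(2) [OF v] C(1) baernstein_norm_nonneg [OF v] by simp
      then show False using * \<open>baernstein_norm c x = 0\<close> by (simp add: \<phi>v)
    qed
    define a where "a = sgn (\<phi> w) / baernstein_norm c x"
    define u where "u = a *\<^sub>R w"
    have "\<bar>a\<bar> \<le> 1 / baernstein_norm c x" using N0 by (simp add: a_def abs_sgn_eq)
    then have "baernstein_norm c u \<le> (1 / baernstein_norm c x) * baernstein_norm c x"
      unfolding u_def baernstein_norm_scaleR [OF w] using wx baernstein_norm_nonneg [OF w] N0
      by (intro mult_mono) auto
    then have "baernstein_norm c u \<le> 1" using N0 by simp
    moreover have "\<phi> u = \<bar>\<phi> w\<bar> / baernstein_norm c x"
      unfolding u_def dual_scaleR [OF \<phi> w] a_def by (simp add: abs_sgn mult.commute)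
    then have "\<epsilon> \<le> \<phi> u" using \<phi>w N0 by (simp add: pos_le_divide_eq)
    moreover have "\<forall>t. t \<notin> E - A \<longrightarrow> u t = 0"
      by (auto simp: u_def w_def v_def restriction_def)
    ultimately show ?thesis using E(1) by (intro exI [of _ u] exI [of _ "E - A"]) auto
  qed
  have many: "\<exists>w E. finite E \<and> E \<inter> A = {} \<and> (\<forall>t. t \<notin> E \<longrightarrow> w t = 0) \<and> (\<forall>t. \<bar>w t\<bar> \<le> 1) \<and>
      baernstein_norm c w \<le> n \<and> n * \<epsilon> \<le> \<phi> w" if A: "finite A" for A and n :: nat
  proof (induction n)
    case 0
    have "\<phi> 0 = 0" using dual_scaleR [OF \<phi> zero_in_space, of 0] by simp
    moreover have "baernstein_norm c 0 = 0" using baernstein_norm_scaleR [OF zero_in_space, of c 0] by simp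
    ultimately show ?case by (intro exI [of _ 0] exI [of _ "{}"]) (auto simp: zero_fun_def)
  next
    case (Suc n)
    then obtain w E where w: "finite E" "E \<inter> A = {}" "\<forall>t. t \<notin> E \<longrightarrow> w t = 0" "\<forall>t. \<bar>w t\<bar> \<le> 1"
      "baernstein_norm c w \<le> n" "n * \<epsilon> \<le> \<phi> w" by blast
    obtain u G where u: "finite G" "G \<inter> (A \<union> E) = {}" "\<forall>t. t \<notin> G \<longrightarrow> u t = 0"
      "baernstein_norm c u \<le> 1" "\<epsilon> \<le> \<phi> u" using bump [of "A \<union> E"] A w(1) by blast
    have wV: "w \<in> baernstein_space c" and uV: "u \<in> baernstein_space c"
      using finite_support_in_space w(1,3) u(1,3) by blast+
    have "\<bar>(w + u) t\<bar> \<le> 1" for t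
      using w(3,4) u(2,3) coordinate_le_norm [OF uV, of t] u(4) by (cases "t \<in> E") force+
    moreover have "baernstein_norm c (w + u) \<le> Suc n"
      using baernstein_norm_add_le [OF wV uV] w(5) u(4) by simp
    moreover have "Suc n * \<epsilon> \<le> \<phi> (w + u)"
      using dual_add [OF \<phi> wV uV] w(6) u(5) by (simp add: algebra_simps)
    moreover have "\<forall>t. t \<notin> E \<union> G \<longrightarrow> (w + u) t = 0" using w u by auto
    ultimately show ?case using w(1,2) u(1,2)
      by (intro exI [of _ "w + u"] exI [of _ "E \<union> G"]) blast
  qed
  have flat: "\<exists>u E. finite E \<and> E \<inter> A = {} \<and> (\<forall>t. t \<notin> E \<longrightarrow> u t = 0) \<and> (\<forall>t. \<bar>u t\<bar> \<le> \<eta>) \<and>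
      baernstein_norm c u \<le> 1 \<and> \<epsilon> \<le> \<phi> u" if A: "finite A" and \<eta>: "0 < \<eta>" for A \<eta>
  proof -
    obtain n :: nat where n: "1 / \<eta> < n" using reals_Archimedean2 by blast
    then have n0: "0 < real n" using \<eta> by (metis less_trans zero_less_divide_1_iff)
    obtain w E where w: "finite E" "E \<inter> A = {}" "\<forall>t. t \<notin> E \<longrightarrow> w t = 0" "\<forall>t. \<bar>w t\<bar> \<le> 1"
      "baernstein_norm c w \<le> n" "n * \<epsilon> \<le> \<phi> w" using many [OF A, of n] by blast
    have wV: "w \<in> baernstein_space c" using finite_support_in_space w(1,3) by blast
    define u where "u = (1 / n) *\<^sub>R w"
    have "\<bar>u t\<bar> \<le> \<eta>" for t
    proof -
      have "\<bar>u t\<bar> \<le> 1 / n" using w(4) n0 by (simp add: u_def divide_right_mono)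
      also have "\<dots> \<le> \<eta>" using n n0 \<eta> by (simp add: field_simps)
      finally show ?thesis .
    qed
    moreover have "baernstein_norm c u \<le> 1"
      unfolding u_def baernstein_norm_scaleR [OF wV] using w(5) n0 by simp
    moreover have "\<epsilon> \<le> \<phi> u"
      unfolding u_def dual_scaleR [OF \<phi> wV] using w(6) n0 by (simp add: field_simps)
    ultimately show ?thesis using w(1-3)
      by (intro exI [of _ u] exI [of _ E]) (auto simp: u_def)
  qed
  have chain: "\<exists>z S. finite S \<and> (\<forall>t. t \<notin> S \<longrightarrow> z t = 0) \<and> (\<Sum>t\<in>S. (z t)\<^sup>2) \<le> real k \<and>
      (baernstein_norm c z)\<^sup>2 \<le> real k * (2 * real m + 2) \<and> k * \<epsilon> \<le> \<phi> z"
    if "k \<le> m\<^sup>2" for k m :: nat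
    using that
  proof (induction k)
    case 0
    have "\<phi> 0 = 0" using dual_scaleR [OF \<phi> zero_in_space, of 0] by simp
    moreover have "baernstein_norm c 0 = 0" using baernstein_norm_scaleR [OF zero_in_space, of c 0] by simp
    ultimately show ?case by (intro exI [of _ 0] exI [of _ "{}"]) (auto simp: zero_fun_def)
  next
    case (Suc k)
    have "k \<le> m\<^sup>2" using Suc.prems by simp
    from Suc.IH [OF this] obtain z S where z: "finite S" "\<forall>t. t \<notin> S \<longrightarrow> z t = 0" "(\<Sum>t\<in>S. (z t)\<^sup>2) \<le> real k"
      "(baernstein_norm c z)\<^sup>2 \<le> real k * (2 * real m + 2)" "real k * \<epsilon> \<le> \<phi> z" by (elim exE conjE) (rule that)
    obtain \<eta> where \<eta>: "0 < \<eta>"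
      "\<And>u. \<lbrakk>u \<in> baernstein_space c; baernstein_norm c u \<le> 1; \<And>t. t \<in> S \<Longrightarrow> u t = 0; \<And>t. \<bar>u t\<bar> \<le> \<eta>\<rbrakk>
      \<Longrightarrow> (baernstein_norm c (z + u))\<^sup>2 \<le> (baernstein_norm c z)\<^sup>2 + 2 * sqrt (\<Sum>t\<in>S. (z t)\<^sup>2) + 2"
      using baernstein_norm_add_flat_le [OF z(1)] z(2) by blast
    obtain u E where u: "finite E" "E \<inter> S = {}" "\<forall>t. t \<notin> E \<longrightarrow> u t = 0" "\<forall>t. \<bar>u t\<bar> \<le> \<eta>"
      "baernstein_norm c u \<le> 1" "\<epsilon> \<le> \<phi> u" using flat [OF z(1) \<eta>(1)] by blast
    have zV: "z \<in> baernstein_space c" and uV: "u \<in> baernstein_space c"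
      using finite_support_in_space z(1,2) u(1,3) by blast+
    have "real k \<le> (real m)\<^sup>2" using \<open>k \<le> m\<^sup>2\<close> by (metis of_nat_le_iff of_nat_power)
    then have "(\<Sum>t\<in>S. (z t)\<^sup>2) \<le> (real m)\<^sup>2" using z(3) by linarith
    then have "sqrt (\<Sum>t\<in>S. (z t)\<^sup>2) \<le> m" by (simp add: real_le_lsqrt)
    moreover have "(baernstein_norm c (z + u))\<^sup>2
        \<le> (baernstein_norm c z)\<^sup>2 + 2 * sqrt (\<Sum>t\<in>S. (z t)\<^sup>2) + 2"
      by (rule \<eta>(2)) (use uV u in auto)
    ultimately have "(baernstein_norm c (z + u))\<^sup>2 \<le> real (Suc k) * (2 * real m + 2)"
      using z(4) by (simp add: algebra_simps)
    moreover have "(\<Sum>t\<in>S \<union> E. ((z + u) t)\<^sup>2) \<le> real (Suc k)"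
    proof -
      have "(\<Sum>t\<in>S \<union> E. ((z + u) t)\<^sup>2) = (\<Sum>t\<in>S. ((z + u) t)\<^sup>2) + (\<Sum>t\<in>E. ((z + u) t)\<^sup>2)"
        using z u by (intro sum.union_disjoint) auto
      also have "\<dots> = (\<Sum>t\<in>S. (z t)\<^sup>2) + (\<Sum>t\<in>E. (u t)\<^sup>2)"
      proof -
        have "u t = 0" if "t \<in> S" for t using u(2,3) that by blast
        moreover have "z t = 0" if "t \<in> E" for t using z(2) u(2) that by blast
        ultimately show ?thesis by simp
      qed
      also have "(\<Sum>t\<in>E. (u t)\<^sup>2) \<le> 1"
        using sum_squares_le_norm [OF uV u(1)] power_le_one [OF baernstein_norm_nonneg [OF uV] u(5), of 2]
        by linarith
      finally show ?thesis using z(3) by simp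
    qed
    moreover have "real (Suc k) * \<epsilon> \<le> \<phi> (z + u)"
      using dual_add [OF \<phi> zV uV] z(5) u(6) by (simp add: algebra_simps)
    moreover have "\<forall>t. t \<notin> S \<union> E \<longrightarrow> (z + u) t = 0" using z u by auto
    ultimately show ?case using z(1) u(1)
      by (intro exI [of _ "z + u"] exI [of _ "S \<union> E"]) blast
  qed
  obtain m :: nat where m: "4 * C\<^sup>2 / \<epsilon>\<^sup>2 < m" using reals_Archimedean2 by blast
  have "0 \<le> 4 * C\<^sup>2 / \<epsilon>\<^sup>2" by simp
  then have m0: "0 < m" using m by linarith
  obtain z S where z: "finite S" "\<forall>t. t \<notin> S \<longrightarrow> z t = 0"
      "(baernstein_norm c z)\<^sup>2 \<le> real (m\<^sup>2) * (2 * real m + 2)" "real (m\<^sup>2) * \<epsilon> \<le> \<phi> z"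
    using chain [OF order_refl, of m] by (elim exE conjE) (rule that)
  have zV: "z \<in> baernstein_space c" using finite_support_in_space z(1,2) by blast
  have "((real m)\<^sup>2 * \<epsilon>)\<^sup>2 \<le> (C * baernstein_norm c z)\<^sup>2"
    using z(4) C(2) [OF zV] \<open>0 < \<epsilon>\<close> by (intro power_mono) auto
  also have "\<dots> \<le> C\<^sup>2 * ((real m)\<^sup>2 * (2 * real m + 2))"
    unfolding power_mult_distrib using z(3) by (intro mult_left_mono) auto
  also have "\<dots> \<le> C\<^sup>2 * ((real m)\<^sup>2 * (4 * real m))" using m0 by (intro mult_left_mono) auto
  finally have "(real m)\<^sup>2 * m * (m * \<epsilon>\<^sup>2) \<le> (real m)\<^sup>2 * m * (4 * C\<^sup>2)"
    by (simp add: power2_eq_square algebra_simps)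
  then have "m * \<epsilon>\<^sup>2 \<le> 4 * C\<^sup>2" using m0 by simp
  then show False using m \<open>0 < \<epsilon>\<close> by (simp add: field_simps)
qed

section \<open>Reflexivity\<close>

lemma dual_norm_le:
  assumes "\<And>x. x \<in> baernstein_space c \<Longrightarrow> \<bar>\<phi> x\<bar> \<le> C * baernstein_norm c x" "0 \<le> C"
  shows "dual_norm (baernstein_space c) (baernstein_norm c) \<phi> \<le> C"
  unfolding dual_norm_def
proof (rule cSUP_least)
  have "baernstein_norm c 0 = 0" using baernstein_norm_scaleR [OF zero_in_space, of c 0] by simp
  then show "{x \<in> baernstein_space c. baernstein_norm c x \<le> 1} \<noteq> {}"
    using zero_in_space by fastforce
  fix x assume "x \<in> {x \<in> baernstein_space c. baernstein_norm c x \<le> 1}"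
  then have "\<bar>\<phi> x\<bar> \<le> C * baernstein_norm c x" "C * baernstein_norm c x \<le> C * 1"
    using assms mult_left_mono [of "baernstein_norm c x" 1 C] by simp_all
  then show "\<bar>\<phi> x\<bar> \<le> C" by linarith
qed

text \<open>
Elements of the dual vanish outside the space, hence the case distinction.
\<close>

definition coefficient_functional :: "('a \<Rightarrow> 'a \<Rightarrow> nat) \<Rightarrow> 'a set \<Rightarrow> ('a \<Rightarrow> real) \<Rightarrow> ('a \<Rightarrow> real) \<Rightarrow> real"
  where "coefficient_functional c A a x = (if x \<in> baernstein_space c then \<Sum>t\<in>A. a t * x t else 0)"

lemma coefficient_functional_dual:
  assumes "finite A" shows "coefficient_functional c A a \<in> baernstein_dual c"
proof -
  have "\<bar>coefficient_functional c A a x\<bar> \<le> (\<Sum>t\<in>A. \<bar>a t\<bar>) * baernstein_norm c x"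
    if "x \<in> baernstein_space c" for x
  proof -
    have "\<bar>\<Sum>t\<in>A. a t * x t\<bar> \<le> (\<Sum>t\<in>A. \<bar>a t\<bar> * \<bar>x t\<bar>)"
      by (rule order_trans [OF sum_abs]) (simp add: abs_mult)
    also have "\<dots> \<le> (\<Sum>t\<in>A. \<bar>a t\<bar> * baernstein_norm c x)"
      by (intro sum_mono mult_left_mono coordinate_le_norm that) simp
    finally show ?thesis using that by (simp add: coefficient_functional_def sum_distrib_right)
  qed
  then have "\<exists>B. \<forall>x\<in>baernstein_space c.
      \<bar>coefficient_functional c A a x\<bar> \<le> B * baernstein_norm c x" by blast
  moreover have "coefficient_functional c A a (x + y)
      = coefficient_functional c A a x + coefficient_functional c A a y"
    if "x \<in> baernstein_space c" "y \<in> baernstein_space c" for x y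
    using that by (simp add: coefficient_functional_def add_in_space distrib_left sum.distrib)
  ultimately show ?thesis
    unfolding dual_space_def
    by (auto simp: coefficient_functional_def add_in_space scaleR_in_space algebra_simps
        sum.distrib sum_distrib_left)
qed

lemma dual_restriction:
  assumes "\<phi> \<in> baernstein_dual c" "finite A" "x \<in> baernstein_space c"
  shows "\<phi> (restriction A x) = (\<Sum>t\<in>A. \<phi> (unit_vector t) * x t)"
  using assms(2)
proof (induction A rule: finite_induct)
  case empty
  have "restriction {} x = 0 *\<^sub>R x" by (auto simp: restriction_def fun_eq_iff)
  then have "\<phi> (restriction {} x) = 0 * \<phi> x" by (metis dual_scaleR [OF assms(1,3)])
  then show ?case by simp
next
  case (insert s A)
  have "restriction (insert s A) x = restriction A x + x s *\<^sub>R unit_vector s"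
    using insert by (auto simp: fun_eq_iff restriction_def unit_vector_def indicator_def)
  then have "\<phi> (restriction (insert s A) x) = \<phi> (restriction A x) + x s * \<phi> (unit_vector s)"
    using dual_add [OF assms(1) restriction_in_space [OF assms(3)] scaleR_in_space]
      dual_scaleR [OF assms(1)] unit_vector_in_space by metis
  then show ?case using insert by (simp add: mult.commute)
qed

text \<open>
The norm of \<open>y\<close> is bounded without an appeal to the Hahn-Banach theorem: for a packing \<open>D\<close> the
functional with coefficients \<open>sgn (y t)\<close> times the \<open>\<ell>\<^sup>1\<close>-norm of \<open>y\<close> on the block of \<open>t\<close> has norm at
most \<open>packing_norm D y\<close>, and \<open>\<Psi>\<close> takes on it the value \<open>(packing_norm D y)\<^sup>2\<close>.
\<close>

lemma baernstein_space_reflexive: "reflexive_on (baernstein_space c) (baernstein_norm c)"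
  unfolding reflexive_on_def
proof
  let ?V = "baernstein_space c" and ?N = "baernstein_norm c" and ?V' = "baernstein_dual c"
  let ?N' = "dual_norm ?V ?N"
  fix \<Psi> assume \<Psi>: "\<Psi> \<in> dual_space ?V' ?N'"
  have \<Psi>_add: "\<Psi> (\<phi> + \<psi>) = \<Psi> \<phi> + \<Psi> \<psi>" if "\<phi> \<in> ?V'" "\<psi> \<in> ?V'" for \<phi> \<psi>
    using \<Psi> that unfolding dual_space_def [of ?V'] by blast
  have \<Psi>_scaleR: "\<Psi> (a *\<^sub>R \<phi>) = a * \<Psi> \<phi>" if "\<phi> \<in> ?V'" for a \<phi>
    using \<Psi> that unfolding dual_space_def [of ?V'] by blast
  obtain B where B: "\<forall>\<phi>\<in>?V'. \<bar>\<Psi> \<phi>\<bar> \<le> B * ?N' \<phi>"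
    using \<Psi> unfolding dual_space_def [of ?V'] by blast
  define K where "K = \<bar>B\<bar>"
  have K: "\<bar>\<Psi> \<phi>\<bar> \<le> K * C"
    if \<phi>: "\<phi> \<in> ?V'" "\<And>x. x \<in> ?V \<Longrightarrow> \<bar>\<phi> x\<bar> \<le> C * ?N x" "0 \<le> C" for \<phi> C
  proof -
    have "?N' \<phi> \<le> C" using \<phi> by (intro dual_norm_le)
    have "0 \<le> ?N' \<phi>"
    proof -
      obtain D where D: "\<And>x. x \<in> ?V \<Longrightarrow> \<bar>\<phi> x\<bar> \<le> D * ?N x" "0 < D"
        using dual_bounded [OF \<phi>(1)] by blast
      have "\<bar>\<phi> x\<bar> \<le> D" if "x \<in> ?V" "?N x \<le> 1" for x
        using D(1) [OF that(1)] mult_left_mono [OF that(2), of D] D(2) by linarith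
      then have "bdd_above ((\<lambda>x. \<bar>\<phi> x\<bar>) ` {x \<in> ?V. ?N x \<le> 1})"
        by (auto simp: bdd_above_def)
      moreover have "0 \<in> {x \<in> ?V. ?N x \<le> 1}"
        using baernstein_norm_scaleR [OF zero_in_space, of c 0] zero_in_space by simp
      ultimately show ?thesis unfolding dual_norm_def by (rule cSUP_upper2) simp
    qed
    have "\<bar>\<Psi> \<phi>\<bar> \<le> B * ?N' \<phi>" using B \<phi>(1) by blast
    also have "\<dots> \<le> K * ?N' \<phi>" using \<open>0 \<le> ?N' \<phi>\<close> by (simp add: K_def mult_right_mono)
    also have "\<dots> \<le> K * C" using \<open>?N' \<phi> \<le> C\<close> by (simp add: K_def mult_left_mono)
    finally show ?thesis .
  qed
  define y where "y = (\<lambda>t. \<Psi> (coefficient_functional c {t} (\<lambda>_. 1)))"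
  have \<Psi>_coefficient: "\<Psi> (coefficient_functional c A a) = (\<Sum>t\<in>A. a t * y t)" if "finite A" for A a
    using that
  proof (induction A rule: finite_induct)
    case empty
    have "coefficient_functional c {} a = 0 *\<^sub>R coefficient_functional c {} a"
      by (simp add: coefficient_functional_def fun_eq_iff)
    then have "\<Psi> (coefficient_functional c {} a) = 0 * \<Psi> (coefficient_functional c {} a)"
      by (metis \<Psi>_scaleR coefficient_functional_dual finite.emptyI)
    then show ?case by simp
  next
    case (insert s A)
    have "coefficient_functional c (insert s A) a
        = coefficient_functional c A a + a s *\<^sub>R coefficient_functional c {s} (\<lambda>_. 1)"
      using insert by (auto simp: coefficient_functional_def fun_eq_iff)
    moreover have "a s *\<^sub>R coefficient_functional c {s} (\<lambda>_. 1) \<in> ?V'"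
    proof -
      have "a s *\<^sub>R coefficient_functional c {s} (\<lambda>_. 1) = coefficient_functional c {s} a"
        by (auto simp: coefficient_functional_def fun_eq_iff)
      then show ?thesis by (simp add: coefficient_functional_dual)
    qed
    ultimately have "\<Psi> (coefficient_functional c (insert s A) a) = \<Psi> (coefficient_functional c A a)
        + \<Psi> (a s *\<^sub>R coefficient_functional c {s} (\<lambda>_. 1))"
      using \<Psi>_add [OF coefficient_functional_dual [OF insert.hyps(1)]] by metis
    moreover have "\<Psi> (a s *\<^sub>R coefficient_functional c {s} (\<lambda>_. 1)) = a s * y s"
      unfolding y_def by (rule \<Psi>_scaleR [OF coefficient_functional_dual]) simp
    ultimately show ?case using insert by simp
  qed
  have "packing_norm D y \<le> K" if D: "D \<in> packings c" for D
  proof -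
    define b where "b = (\<lambda>F. \<Sum>t\<in>F. \<bar>y t\<bar>)"
    define G where "G = (\<lambda>t. THE F. F \<in> D \<and> t \<in> F)"
    have G: "G t = F" if "F \<in> D" "t \<in> F" for F t
      unfolding G_def by (rule the_equality) (use that packing_unique [OF D] in blast)+
    define a where "a = (\<lambda>t. sgn (y t) * b (G t))"
    have fin: "finite D" "finite (\<Union>D)" "\<And>F. F \<in> D \<Longrightarrow> finite F"
      by (rule packing_finite [OF D], rule packing_Union_finite [OF D],
          rule block_finite [OF packing_block [OF D]])
    have Union: "(\<Sum>t\<in>\<Union>D. g t) = (\<Sum>F\<in>D. \<Sum>t\<in>F. g t)" for g :: "'a \<Rightarrow> real"
    proof -
      have "\<forall>F\<in>D. \<forall>G\<in>D. F \<noteq> G \<longrightarrow> F \<inter> G = {}" using packing_unique [OF D] by blast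
      then show ?thesis using fin(3) by (simp add: sum.Union_disjoint)
    qed
    have b: "0 \<le> b F" for F by (simp add: b_def sum_nonneg)
    have "\<bar>coefficient_functional c (\<Union>D) a x\<bar> \<le> packing_norm D y * ?N x" if x: "x \<in> ?V" for x
    proof -
      have "\<bar>\<Sum>t\<in>\<Union>D. a t * x t\<bar> \<le> (\<Sum>t\<in>\<Union>D. \<bar>a t * x t\<bar>)" by (rule sum_abs)
      also have "\<dots> \<le> (\<Sum>F\<in>D. b F * (\<Sum>t\<in>F. \<bar>x t\<bar>))"
        unfolding Union sum_distrib_left
        by (intro sum_mono) (auto simp: a_def G abs_mult b abs_sgn_eq)
      also have "\<dots> \<le> L2_set b D * packing_norm D x"
        using L2_set_mult_ineq [of b "\<lambda>F. \<Sum>t\<in>F. \<bar>x t\<bar>" D]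
        by (simp add: packing_norm_def b sum_nonneg)
      also have "\<dots> \<le> L2_set b D * ?N x"
        by (intro mult_left_mono packing_norm_le_norm x D) simp
      finally show ?thesis using x by (simp add: coefficient_functional_def packing_norm_def b_def)
    qed
    then have "\<bar>\<Psi> (coefficient_functional c (\<Union>D) a)\<bar> \<le> K * packing_norm D y"
      using coefficient_functional_dual [OF fin(2)] by (intro K packing_norm_nonneg)
    moreover have "\<Psi> (coefficient_functional c (\<Union>D) a) = (packing_norm D y)\<^sup>2"
    proof -
      have "\<Psi> (coefficient_functional c (\<Union>D) a) = (\<Sum>F\<in>D. \<Sum>t\<in>F. b F * \<bar>y t\<bar>)"
        unfolding \<Psi>_coefficient [OF fin(2)] Union
        by (intro sum.cong refl) (auto simp: a_def G abs_sgn)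
      also have "\<dots> = (\<Sum>F\<in>D. (b F)\<^sup>2)"
        by (simp add: b_def power2_eq_square flip: sum_distrib_left)
      finally show ?thesis by (simp add: packing_norm_power2 b_def)
    qed
    ultimately have "packing_norm D y * packing_norm D y \<le> K * packing_norm D y"
      by (simp add: power2_eq_square)
    then show ?thesis
      using packing_norm_nonneg [of D y] by (cases "packing_norm D y = 0") (auto simp: K_def)
  qed
  then have y: "y \<in> ?V" by (rule baernstein_norm_leI(1))
  have "\<Psi> \<phi> = \<phi> y" if \<phi>: "\<phi> \<in> ?V'" for \<phi>
  proof -
    have "\<bar>\<Psi> \<phi> - \<phi> y\<bar> \<le> 0 + e" if "0 < e" for e
    proof -
      define \<epsilon> where "\<epsilon> = e / (K + ?N y + 1)"
      have pos: "0 < K + ?N y + 1" using baernstein_norm_nonneg [OF y] by (simp add: K_def)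
      then have "0 < \<epsilon>" using that by (simp add: \<epsilon>_def)
      from dual_shrinking [OF \<phi> this] obtain A where A: "finite A"
        "\<And>x. x \<in> ?V \<Longrightarrow> \<bar>\<phi> x - \<phi> (restriction A x)\<bar> \<le> \<epsilon> * ?N x"
        by blast
      define \<phi>A where "\<phi>A = coefficient_functional c A (\<lambda>t. \<phi> (unit_vector t))"
      have \<phi>A: "\<phi>A \<in> ?V'" "\<And>x. x \<in> ?V \<Longrightarrow> \<phi>A x = \<phi> (restriction A x)"
        using coefficient_functional_dual [OF A(1)] dual_restriction [OF \<phi> A(1)]
        by (auto simp: \<phi>A_def coefficient_functional_def)
      have "\<phi> - \<phi>A \<in> ?V'"
      proof -
        have "(\<phi> - \<phi>A) (x + z) = (\<phi> - \<phi>A) x + (\<phi> - \<phi>A) z" if "x \<in> ?V" "z \<in> ?V" for x z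
          using dual_add [OF \<phi> that(1,2)] dual_add [OF \<phi>A(1) that(1,2)] by simp
        moreover have "(\<phi> - \<phi>A) (r *\<^sub>R x) = r * (\<phi> - \<phi>A) x" if "x \<in> ?V" for x r
          using dual_scaleR [OF \<phi> that] dual_scaleR [OF \<phi>A(1) that] by (simp add: algebra_simps)
        moreover have "\<bar>(\<phi> - \<phi>A) x\<bar> \<le> \<epsilon> * ?N x" if "x \<in> ?V" for x
          using A(2) \<phi>A(2) that by simp
        moreover have "(\<phi> - \<phi>A) x = 0" if "x \<notin> ?V" for x
          using \<phi> \<phi>A(1) that by (simp add: dual_space_def)
        ultimately show ?thesis unfolding dual_space_def by blast
      qed
      moreover have "\<Psi> \<phi> = \<Psi> (\<phi> - \<phi>A) + \<Psi> \<phi>A"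
        using \<Psi>_add [OF \<open>\<phi> - \<phi>A \<in> ?V'\<close> \<phi>A(1)] by simp
      moreover have "\<Psi> \<phi>A = \<phi> (restriction A y)"
        unfolding \<phi>A_def \<Psi>_coefficient [OF A(1)] dual_restriction [OF \<phi> A(1) y] ..
      moreover have "\<bar>\<Psi> (\<phi> - \<phi>A)\<bar> \<le> K * \<epsilon>"
        using \<open>\<phi> - \<phi>A \<in> ?V'\<close> by (rule K) (use A(2) \<phi>A(2) \<open>0 < \<epsilon>\<close> in auto)
      moreover have "\<bar>\<phi> y - \<phi> (restriction A y)\<bar> \<le> \<epsilon> * ?N y" by (rule A(2) [OF y])
      moreover have "K * \<epsilon> + \<epsilon> * ?N y \<le> e"
      proof -
        have "\<epsilon> * (K + ?N y + 1) = e" using pos by (simp add: \<epsilon>_def)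
        then show ?thesis using \<open>0 < \<epsilon>\<close> by (simp add: algebra_simps)
      qed
      ultimately show ?thesis by linarith
    qed
    then have "\<bar>\<Psi> \<phi> - \<phi> y\<bar> \<le> 0" by (rule field_le_epsilon)
    then show ?thesis by simp
  qed
  then show "\<exists>y\<in>?V. \<forall>\<phi>\<in>?V'. \<Psi> \<phi> = \<phi> y" using y by blast
qed

section \<open>Weakly compact balls and the constant multifunction\<close>

definition baernstein_ball :: "('a \<Rightarrow> 'a \<Rightarrow> nat) \<Rightarrow> real \<Rightarrow> ('a \<Rightarrow> real) set"
  where "baernstein_ball c r = {x \<in> baernstein_space c. baernstein_norm c x \<le> r}"

text \<open>
Compactness here refers to the topology of coordinatewise convergence: the ball is a closed subset of
a cube.
\<close>

lemma baernstein_ball_compact: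
  assumes "0 \<le> r"
  shows "compact (baernstein_ball c r)"
proof -
  have eq: "baernstein_ball c r
      = (\<Inter>D\<in>packings c. {x. packing_norm D x \<le> r}) \<inter> (UNIV \<rightarrow> {-r..r})"
  proof (intro equalityI subsetI)
    fix x assume "x \<in> baernstein_ball c r"
    then have x: "x \<in> baernstein_space c" "baernstein_norm c x \<le> r"
      by (auto simp: baernstein_ball_def)
    show "x \<in> (\<Inter>D\<in>packings c. {x. packing_norm D x \<le> r}) \<inter> (UNIV \<rightarrow> {-r..r})"
    proof -
      have "packing_norm D x \<le> r" if "D \<in> packings c" for D
        using packing_norm_le_norm [OF x(1) that] x(2) by linarith
      moreover have "x t \<in> {-r..r}" for t
        using coordinate_le_norm [OF x(1), of t] x(2) by (auto simp: abs_le_iff)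
      ultimately show ?thesis by simp
    qed
  qed (auto simp: baernstein_ball_def intro: baernstein_norm_leI)
  have "closed {x. packing_norm D x \<le> r}" for D :: "'a set set"
    unfolding packing_norm_def L2_set_def
    by (intro closed_Collect_le continuous_on_real_sqrt continuous_on_sum continuous_on_power
        continuous_on_rabs continuous_on_const continuous_on_product_coordinates)
  moreover have "compact (UNIV \<rightarrow> {-r..r} :: ('a \<Rightarrow> real) set)"
  proof -
    have "compactin (product_topology (\<lambda>_::'a. euclideanreal) UNIV) (PiE UNIV (\<lambda>_. {-r..r}))"
      by (simp add: compactin_PiE)
    then show ?thesis by (simp add: euclidean_product_topology PiE_UNIV_domain)
  qed
  ultimately show ?thesis unfolding eq by (intro closed_Int_compact closed_INT ballI)
qed

text \<open>
On a ball, \<open>\<phi>\<close> is a uniform limit of finite combinations of coordinates.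
\<close>

lemma dual_continuous_on_ball:
  assumes \<phi>: "\<phi> \<in> baernstein_dual c" and "0 \<le> r"
  shows "continuous_on (baernstein_ball c r) \<phi>"
proof -
  have "\<exists>A. finite A \<and> (\<forall>x\<in>baernstein_ball c r. dist (\<phi> (restriction A x)) (\<phi> x) < 1 / Suc n)" for n
  proof -
    have "0 < 1 / (Suc n * (r + 1))" using \<open>0 \<le> r\<close> by simp
    from dual_shrinking [OF \<phi> this] obtain A where A: "finite A"
      "\<And>x. x \<in> baernstein_space c \<Longrightarrow>
        \<bar>\<phi> x - \<phi> (restriction A x)\<bar> \<le> 1 / (Suc n * (r + 1)) * baernstein_norm c x"
      by blast
    have "dist (\<phi> (restriction A x)) (\<phi> x) < 1 / Suc n" if "x \<in> baernstein_ball c r" for x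
    proof -
      have x: "x \<in> baernstein_space c" "baernstein_norm c x \<le> r"
        using that by (auto simp: baernstein_ball_def)
      have "dist (\<phi> (restriction A x)) (\<phi> x) \<le> 1 / (Suc n * (r + 1)) * baernstein_norm c x"
        using A(2) [OF x(1)] by (simp add: dist_real_def abs_minus_commute)
      also have "\<dots> < 1 / (Suc n * (r + 1)) * (r + 1)"
        using x(2) \<open>0 \<le> r\<close> by (intro mult_strict_left_mono) auto
      also have "\<dots> = 1 / Suc n" using \<open>0 \<le> r\<close> by simp
      finally show ?thesis .
    qed
    then show ?thesis using A(1) by blast
  qed
  then obtain A where A: "\<And>n. finite (A n)"
    "\<And>n x. x \<in> baernstein_ball c r \<Longrightarrow> dist (\<phi> (restriction (A n) x)) (\<phi> x) < 1 / Suc n"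
    by metis
  show ?thesis
  proof (rule uniform_limit_theorem)
    show "\<forall>\<^sub>F n in sequentially. continuous_on (baernstein_ball c r) (\<lambda>x. \<phi> (restriction (A n) x))"
    proof (intro always_eventually allI)
      fix n
      have "continuous_on (baernstein_ball c r) (\<lambda>x. \<Sum>t\<in>A n. \<phi> (unit_vector t) * x t)"
        by (intro continuous_intros continuous_on_subset [OF continuous_on_product_coordinates]) auto
      then show "continuous_on (baernstein_ball c r) (\<lambda>x. \<phi> (restriction (A n) x))"
        by (rule continuous_on_eq)
          (simp add: baernstein_ball_def dual_restriction [OF \<phi> A(1)])
    qed
    show "uniform_limit (baernstein_ball c r) (\<lambda>n x. \<phi> (restriction (A n) x)) \<phi> sequentially"
    proof (rule uniform_limitI)
      fix e :: real assume "0 < e"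
      then obtain k where "1 / Suc k < e" using nat_approx_posE by blast
      then have "\<forall>x\<in>baernstein_ball c r. dist (\<phi> (restriction (A n) x)) (\<phi> x) < e" if "k \<le> n" for n
      proof -
        have "1 / real (Suc n) \<le> 1 / Suc k" using that by (simp add: frac_le)
        then show ?thesis using A(2) [of _ n] \<open>1 / Suc k < e\<close> by fastforce
      qed
      then show "\<forall>\<^sub>F n in sequentially. \<forall>x\<in>baernstein_ball c r.
          dist (\<phi> (restriction (A n) x)) (\<phi> x) < e"
        by (auto simp: eventually_sequentially)
    qed
  qed simp
qed

lemma baernstein_ball_cwk:
  assumes "0 \<le> r"
  shows "baernstein_ball c r \<in> cwk (baernstein_space c) (baernstein_norm c)"
proof -
  let ?B = "baernstein_ball c r"
  let ?W = "weak_topology (baernstein_space c) (baernstein_norm c)"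
  have "0 \<in> ?B"
    using baernstein_norm_scaleR [OF zero_in_space, of c 0] zero_in_space assms
    by (simp add: baernstein_ball_def)
  have "convex ?B"
  proof (rule convexI)
    fix x y and u v :: real
    assume "x \<in> ?B" "y \<in> ?B" and uv: "0 \<le> u" "0 \<le> v" "u + v = 1"
    then have x: "x \<in> baernstein_space c" "baernstein_norm c x \<le> r"
      and y: "y \<in> baernstein_space c" "baernstein_norm c y \<le> r"
      by (auto simp: baernstein_ball_def)
    have "baernstein_norm c (u *\<^sub>R x + v *\<^sub>R y) \<le> u * baernstein_norm c x + v * baernstein_norm c y"
      using baernstein_norm_add_le [OF scaleR_in_space [OF x(1)] scaleR_in_space [OF y(1)], of u v] uv
      by (simp add: baernstein_norm_scaleR x y)
    also have "\<dots> \<le> u * r + v * r" using x y uv by (intro add_mono mult_left_mono)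
    also have "\<dots> = r" using uv by (simp flip: distrib_right)
    finally show "u *\<^sub>R x + v *\<^sub>R y \<in> ?B"
      using x y by (simp add: baernstein_ball_def add_in_space scaleR_in_space)
  qed
  moreover have "compactin ?W ?B"
  proof -
    have "continuous_map (top_of_set ?B) ?W (\<lambda>x. x)"
      unfolding weak_topology_def
    proof (rule continuous_on_generated_topo)
      fix U assume "U \<in> {{x \<in> baernstein_space c. \<phi> x \<in> U} |\<phi> U.
        \<phi> \<in> baernstein_dual c \<and> open U}"
      then obtain \<phi> T where U: "U = {x \<in> baernstein_space c. \<phi> x \<in> T}"
        and \<phi>: "\<phi> \<in> baernstein_dual c" and "open T" by blast
      have "openin (top_of_set ?B) (?B \<inter> \<phi> -` T)"
        using dual_continuous_on_ball [OF \<phi> assms] \<open>open T\<close>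
        by (simp add: continuous_on_open_gen continuous_openin_preimage_gen)
      moreover have "?B \<inter> \<phi> -` T = (\<lambda>x. x) -` U \<inter> topspace (top_of_set ?B)"
        by (auto simp: U baernstein_ball_def)
      ultimately show "openin (top_of_set ?B) ((\<lambda>x. x) -` U \<inter> topspace (top_of_set ?B))" by simp
    next
      let ?\<phi> = "coefficient_functional c {} (\<lambda>_. 0)"
      let ?S = "{{x \<in> baernstein_space c. \<phi> x \<in> U} |\<phi> U. \<phi> \<in> baernstein_dual c \<and> open U}"
      have "?\<phi> \<in> baernstein_dual c" by (rule coefficient_functional_dual) simp
      then have "{x \<in> baernstein_space c. ?\<phi> x \<in> UNIV} \<in> ?S" using open_UNIV by blast
      moreover have "?B \<subseteq> {x \<in> baernstein_space c. ?\<phi> x \<in> UNIV}"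
        by (auto simp: baernstein_ball_def)
      ultimately have "?B \<subseteq> \<Union> ?S" by (meson Union_upper order_trans)
      then show "(\<lambda>x. x) ` topspace (top_of_set ?B) \<subseteq> \<Union> ?S" by simp
    qed
    moreover have "compactin (top_of_set ?B) ?B"
      using baernstein_ball_compact [OF assms] by (simp add: compactin_subtopology)
    ultimately have "compactin ?W ((\<lambda>x. x) ` ?B)" by (rule image_compactin [rotated])
    then show ?thesis by simp
  qed
  ultimately show ?thesis using \<open>0 \<in> ?B\<close> unfolding cwk_def by blast
qed

lemma baernstein_ball_scaleR:
  assumes "0 < r"
  shows "(\<lambda>x. r *\<^sub>R x) ` baernstein_ball c 1 = baernstein_ball c r"
proof (intro equalityI subsetI)
  fix x assume "x \<in> (\<lambda>x. r *\<^sub>R x) ` baernstein_ball c 1"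
  then show "x \<in> baernstein_ball c r"
    using assms by (auto simp: baernstein_ball_def baernstein_norm_scaleR scaleR_in_space)
next
  fix x assume x: "x \<in> baernstein_ball c r"
  then have "(1 / r) *\<^sub>R x \<in> baernstein_ball c 1"
    using assms by (simp add: baernstein_ball_def baernstein_norm_scaleR scaleR_in_space)
  moreover have "x = r *\<^sub>R ((1 / r) *\<^sub>R x)" using assms by simp
  ultimately show "x \<in> (\<lambda>x. r *\<^sub>R x) ` baernstein_ball c 1" by blast
qed

lemma baernstein_ball_add:
  assumes "0 < r" "0 < s"
  shows "baernstein_ball c (r + s) = baernstein_ball c r + baernstein_ball c s"
proof (intro equalityI subsetI)
  fix x assume "x \<in> baernstein_ball c (r + s)"
  then have x: "x \<in> baernstein_space c" "baernstein_norm c x \<le> r + s"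
    by (auto simp: baernstein_ball_def)
  have part: "(q / (r + s)) *\<^sub>R x \<in> baernstein_ball c q" if "0 < q" for q
  proof -
    have "q * baernstein_norm c x \<le> q * (r + s)" using x that by (intro mult_left_mono) auto
    then show ?thesis
      using x assms that
      by (simp add: baernstein_ball_def baernstein_norm_scaleR scaleR_in_space pos_divide_le_eq)
  qed
  have "x = (r / (r + s)) *\<^sub>R x + (s / (r + s)) *\<^sub>R x"
    using assms by (simp flip: scaleR_add_left add_divide_distrib)
  then show "x \<in> baernstein_ball c r + baernstein_ball c s"
    using part assms set_plus_intro by metis
next
  fix x assume "x \<in> baernstein_ball c r + baernstein_ball c s"
  then obtain y z where "x = y + z" "y \<in> baernstein_ball c r" "z \<in> baernstein_ball c s"
    by (rule set_plus_elim)
  then show "x \<in> baernstein_ball c (r + s)"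
    using baernstein_norm_add_le [of y c z] by (auto simp: baernstein_ball_def add_in_space)
qed

lemma measure_subinterval_pos:
  assumes "I \<in> subintervals" shows "0 < measure lborel I"
  using assms by (auto simp: subintervals_def)

lemma measure_subinterval_Un:
  assumes "I \<in> subintervals" "J \<in> subintervals" "interior I \<inter> interior J = {}"
  shows "measure lborel (I \<union> J) = measure lborel I + measure lborel J"
proof -
  obtain a b p q where IJ: "I = {a..b}" "J = {p..q}"
    using assms by (auto simp: subintervals_def)
  have "{max a p<..<min b q} = {}"
    using assms(3) by (simp add: IJ interior_atLeastAtMost_real)
  then have "min b q \<le> max a p" by simp
  then have "measure lborel (I \<inter> J) = 0"
    unfolding IJ Int_atLeastAtMost by (cases "min b q = max a p") auto
  then show ?thesis
    using measure_Un3 [of I lborel J] by (simp add: IJ fmeasurable_compact)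
qed

lemma hausdorff_distance_self:
  assumes "A \<subseteq> baernstein_space c" "A \<noteq> {}"
  shows "hausdorff_distance (baernstein_norm c) A A = 0"
proof -
  have zero: "baernstein_norm c 0 = 0" using baernstein_norm_scaleR [OF zero_in_space, of c 0] by simp
  have nonneg: "0 \<le> baernstein_norm c (x - y)" if "x \<in> A" "y \<in> A" for x y
    using assms(1) that by (intro baernstein_norm_nonneg diff_in_space) auto
  have 1: "(INF b\<in>A. baernstein_norm c (a - b)) = 0" if "a \<in> A" for a
  proof (rule antisym)
    show "(INF b\<in>A. baernstein_norm c (a - b)) \<le> 0"
      using that zero nonneg by (intro cINF_lower2 [of _ _ a] bdd_belowI2 [where m = 0]) auto
    show "0 \<le> (INF b\<in>A. baernstein_norm c (a - b))"
      using that nonneg by (intro cINF_greatest) auto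
  qed
  have 2: "(INF a\<in>A. baernstein_norm c (a - b)) = 0" if "b \<in> A" for b
  proof (rule antisym)
    show "(INF a\<in>A. baernstein_norm c (a - b)) \<le> 0"
      using that zero nonneg by (intro cINF_lower2 [of _ _ b] bdd_belowI2 [where m = 0]) auto
    show "0 \<le> (INF a\<in>A. baernstein_norm c (a - b))"
      using that nonneg by (intro cINF_greatest) auto
  qed
  show ?thesis using assms(2) by (simp add: hausdorff_distance_def 1 2)
qed

text \<open>
Any gauge works, because \<open>\<Phi>(I)\<close> and \<open>|I| B\<close> coincide.
\<close>

lemma constant_ball_variationally_McShane:
  "variationally_McShane_integrable (baernstein_space c) (baernstein_norm c) (\<lambda>_. baernstein_ball c 1)"
  unfolding variationally_McShane_integrable_def
proof (intro exI conjI allI impI ballI)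
  let ?\<Phi> = "\<lambda>I. baernstein_ball c (measure lborel I)"
  show "?\<Phi> I \<in> cwk (baernstein_space c) (baernstein_norm c)" for I
    by (rule baernstein_ball_cwk) simp
  show "finitely_additive ?\<Phi>"
    unfolding finitely_additive_def
    using measure_subinterval_Un measure_subinterval_pos baernstein_ball_add by metis
  fix \<epsilon> :: real assume "0 < \<epsilon>"
  show "gauge01 (\<lambda>_. 1)" by (simp add: gauge01_def)
  fix P assume P: "partition01 P \<and> delta_fine (\<lambda>_. 1) P"
  have "(\<Sum>(I, t)\<in>P. hausdorff_distance (baernstein_norm c) (?\<Phi> I)
      ((\<lambda>y. measure lborel I *\<^sub>R y) ` baernstein_ball c 1)) = 0"
  proof (intro sum.neutral ballI, clarify)
    fix I t assume "(I, t) \<in> P"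
    then have "I \<in> subintervals" using P by (auto simp: partition01_def)
    then have eq: "(\<lambda>y. measure lborel I *\<^sub>R y) ` baernstein_ball c 1 = ?\<Phi> I"
      by (intro baernstein_ball_scaleR measure_subinterval_pos)
    show "hausdorff_distance (baernstein_norm c) (?\<Phi> I)
      ((\<lambda>y. measure lborel I *\<^sub>R y) ` baernstein_ball c 1) = 0"
      unfolding eq
    proof (rule hausdorff_distance_self)
      show "?\<Phi> I \<subseteq> baernstein_space c" by (auto simp: baernstein_ball_def)
      show "?\<Phi> I \<noteq> {}"
        using baernstein_ball_cwk [of "measure lborel I" c] by (simp add: cwk_def)
    qed
  qed
  then show "(\<Sum>(I, t)\<in>P. hausdorff_distance (baernstein_norm c) (?\<Phi> I)
      ((\<lambda>y. measure lborel I *\<^sub>R y) ` baernstein_ball c 1)) < \<epsilon>"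
    using \<open>0 < \<epsilon>\<close> by simp
qed

section \<open>The unit vectors are scalarly null\<close>

text \<open>
For each positive \<open>\<epsilon>\<close>, only the finitely many coordinates given by \<open>dual_shrinking\<close> can carry a value
greater than \<open>\<epsilon>\<close>.
\<close>

lemma dual_unit_vector_countable:
  assumes \<phi>: "\<phi> \<in> baernstein_dual c"
  shows "countable {t. \<phi> (unit_vector t) \<noteq> 0}"
proof -
  have fin: "finite {t. \<epsilon> < \<bar>\<phi> (unit_vector t)\<bar>}" if \<epsilon>: "0 < \<epsilon>" for \<epsilon>
  proof -
    from dual_shrinking [OF \<phi> \<epsilon>] obtain A where A: "finite A"
      "\<And>x. x \<in> baernstein_space c \<Longrightarrow> \<bar>\<phi> x - \<phi> (restriction A x)\<bar> \<le> \<epsilon> * baernstein_norm c x"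
      by blast
    have "\<bar>\<phi> (unit_vector t)\<bar> \<le> \<epsilon>" if "t \<notin> A" for t
    proof -
      have "restriction A (unit_vector t) = 0 *\<^sub>R unit_vector t"
        using that by (auto simp: restriction_def unit_vector_def indicator_def fun_eq_iff)
      then have "\<phi> (restriction A (unit_vector t)) = 0 * \<phi> (unit_vector t)"
        by (metis dual_scaleR [OF \<phi> unit_vector_in_space])
      then have "\<bar>\<phi> (unit_vector t)\<bar> \<le> \<epsilon> * baernstein_norm c (unit_vector t)"
        using A(2) [OF unit_vector_in_space, of t] by simp
      also have "\<dots> \<le> \<epsilon> * 1"
        using \<epsilon> baernstein_norm_unit_vector_le by (intro mult_left_mono) auto
      finally show ?thesis by simp
    qed
    then have "{t. \<epsilon> < \<bar>\<phi> (unit_vector t)\<bar>} \<subseteq> A" by (auto simp: not_less [symmetric])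
    then show ?thesis using A(1) finite_subset by blast
  qed
  then have "countable (\<Union>n. {t. 1 / Suc n < \<bar>\<phi> (unit_vector t)\<bar>})"
    by (intro countable_UN countableI_type countable_finite [OF fin]) simp
  moreover have "{t. \<phi> (unit_vector t) \<noteq> 0} \<subseteq> (\<Union>n. {t. 1 / Suc n < \<bar>\<phi> (unit_vector t)\<bar>})"
  proof
    fix t assume "t \<in> {t. \<phi> (unit_vector t) \<noteq> 0}"
    then have "0 < \<bar>\<phi> (unit_vector t)\<bar>" by simp
    then obtain n where "1 / Suc n < \<bar>\<phi> (unit_vector t)\<bar>" by (rule nat_approx_posE)
    then show "t \<in> (\<Union>n. {t. 1 / Suc n < \<bar>\<phi> (unit_vector t)\<bar>})" by blast
  qed
  ultimately show ?thesis by (rule countable_subset [rotated])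
qed

lemma unit_vector_scalarly_measurable:
  "scalarly_measurable (baernstein_space c) (baernstein_norm c) unit_vector"
  unfolding scalarly_measurable_def
proof
  fix \<phi> assume \<phi>: "\<phi> \<in> baernstein_dual c"
  have "(\<lambda>t::real. \<phi> (unit_vector t)) \<in> borel_measurable borel"
  proof (rule measurable_discrete_difference [where f = "\<lambda>_. 0" and X = "{t. \<phi> (unit_vector t) \<noteq> 0}"])
    show "countable {t. \<phi> (unit_vector t) \<noteq> 0}" by (rule dual_unit_vector_countable [OF \<phi>])
  qed auto
  then show "(\<lambda>t. \<phi> (unit_vector t)) \<in> borel_measurable (lebesgue_on {0..1})"
    by (intro measurable_restrict_space1 measurable_completion) simp
qed

section \<open>Uncountably many disjoint thick sets\<close>

lemma uncountable_fiber:
  fixes P :: "'a \<Rightarrow> 'b::countable \<Rightarrow> bool"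
  assumes "uncountable L" "\<And>l. l \<in> L \<Longrightarrow> \<exists>n. P l n"
  obtains n where "uncountable {l \<in> L. P l n}"
proof -
  have "L \<subseteq> (\<Union>n. {l \<in> L. P l n})" using assms(2) by blast
  then have "uncountable (\<Union>n. {l \<in> L. P l n})" using assms(1) countable_subset by blast
  then show ?thesis using that by (meson countable_UN countableI_type)
qed


lemma sum_list_of_rat_scale:
  "(\<Sum>(q, x)\<leftarrow>map (\<lambda>(q, x). (r * q, x)) xs. of_rat q * x)
    = of_rat r * (\<Sum>(q, x)\<leftarrow>xs. of_rat q * x :: real)"
  by (induction xs) (auto simp: of_rat_mult distrib_left)

text \<open>
Split a Hamel basis of the reals over the rationals into countably many uncountable pieces, and let
\<open>G n\<close> be the span of the pieces up to \<open>n\<close>. Every real is a combination of finitely many basis elements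
and so lies in some \<open>G n\<close>, and different elements of the next piece \<open>C n\<close> represent different cosets.
\<close>

lemma real_union_of_groups_with_uncountably_many_cosets:
  obtains G C :: "nat \<Rightarrow> real set"
  where "(\<Union>n. G n) = UNIV" "\<And>n. uncountable (C n)"
    "\<And>n b b' x y. \<lbrakk>b \<in> C n; b' \<in> C n; x \<in> G n; y \<in> G n; b + x = b' + y\<rbrakk> \<Longrightarrow> b = b'"
proof -
  interpret Q: vector_space "\<lambda>(q::rat) (x::real). of_rat q * x"
    by standard (auto simp: algebra_simps of_rat_add of_rat_mult)
  define B where "B = Q.extend_basis {}"
  have B: "Q.independent B" "Q.span B = UNIV"
    unfolding B_def
    by (rule Q.independent_extend_basis [OF Q.independent_empty],
        rule Q.span_extend_basis [OF Q.independent_empty])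
  have unc: "uncountable B"
  proof
    assume "countable B"
    \<comment> \<open>The rational combinations of a countable basis, enumerated by lists, would exhaust the reals.\<close>
    define T where "T = (\<lambda>xs. \<Sum>(q, x)\<leftarrow>xs. of_rat q * x) ` lists (UNIV \<times> B)"
    have "countable T" unfolding T_def using \<open>countable B\<close> by auto
    have "Q.subspace T"
    proof (rule Q.subspaceI)
      show "0 \<in> T" unfolding T_def by (rule image_eqI [of _ _ "[]"]) auto
      show "x + y \<in> T" if xy: "x \<in> T" "y \<in> T" for x y
      proof -
        obtain xs ys where "xs \<in> lists (UNIV \<times> B)" "x = (\<Sum>(q, x)\<leftarrow>xs. of_rat q * x)"
          "ys \<in> lists (UNIV \<times> B)" "y = (\<Sum>(q, x)\<leftarrow>ys. of_rat q * x)"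
          using xy unfolding T_def by blast
        then show ?thesis unfolding T_def by (intro image_eqI [of _ _ "xs @ ys"]) auto
      qed
      show "of_rat r * x \<in> T" if x: "x \<in> T" for r x
      proof -
        obtain xs where xs: "xs \<in> lists (UNIV \<times> B)" "x = (\<Sum>(q, x)\<leftarrow>xs. of_rat q * x)"
          using x unfolding T_def by blast
        have "of_rat r * x = (\<Sum>(q, x)\<leftarrow>map (\<lambda>(q, x). (r * q, x)) xs. of_rat q * x)"
          unfolding xs(2) by (rule sum_list_of_rat_scale [symmetric])
        then show ?thesis using xs(1) unfolding T_def
          by (intro image_eqI [of _ _ "map (\<lambda>(q, x). (r * q, x)) xs"]) auto
      qed
    qed
    moreover have "B \<subseteq> T"
    proof
      fix b assume "b \<in> B"
      then show "b \<in> T" unfolding T_def by (intro image_eqI [of _ _ "[(1, b)]"]) auto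
    qed
    ultimately have "UNIV \<subseteq> T" using Q.span_minimal B(2) by metis
    then show False
      using \<open>countable T\<close> countable_subset uncountable_UNIV_real by blast
  qed
  then have "infinite B" using countable_finite by blast
  then obtain f where f: "bij_betw f (B \<times> (UNIV :: nat set)) B"
    using card_of_Times_infinite [of B "UNIV :: nat set"] infinite_iff_card_of_nat card_of_ordIso
    by blast
  define G where "G = (\<lambda>n. Q.span (f ` (B \<times> {..n})))"
  define C where "C = (\<lambda>n. f ` (B \<times> {Suc n}))"
  have fB: "f p \<in> B" if "p \<in> B \<times> UNIV" for p using f that by (auto simp: bij_betw_def)
  have f_inj: "inj_on f (B \<times> UNIV)" using f by (simp add: bij_betw_def)
  show ?thesis
  proof
    show "(\<Union>n. G n) = UNIV"
    proof (intro equalityI subsetI UNIV_I)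
      fix x :: real
      have "x \<in> Q.span B" using B(2) by simp
      then obtain t r where t: "finite t" "t \<subseteq> B" "x = (\<Sum>a\<in>t. of_rat (r a) * a)"
        unfolding Q.span_explicit by blast
      have "t \<subseteq> f ` (B \<times> UNIV)" using t(2) f by (simp add: bij_betw_def)
      then obtain p where p: "finite p" "p \<subseteq> B \<times> UNIV" "t = f ` p"
        using finite_subset_image [OF t(1)] by metis
      obtain n where "\<forall>m\<in>snd ` p. m \<le> n"
        using p(1) finite_nat_set_iff_bounded_le [of "snd ` p"] by auto
      then have "t \<subseteq> f ` (B \<times> {..n})" using p by force
      then have "x \<in> G n"
        unfolding G_def t(3) by (intro Q.span_sum Q.span_scale Q.span_base) auto
      then show "x \<in> (\<Union>n. G n)" by blast
    qed
    show "uncountable (C n)" for n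
    proof
      assume "countable (C n)"
      moreover have "inj_on (\<lambda>b. f (b, Suc n)) B"
        using f_inj by (auto simp: inj_on_def)
      moreover have "C n = (\<lambda>b. f (b, Suc n)) ` B" by (auto simp: C_def)
      ultimately have "countable B" by (simp add: countable_image_inj_eq)
      then show False using unc by blast
    qed
    fix n b b' x y
    assume b: "b \<in> C n" "b' \<in> C n" and xy: "x \<in> G n" "y \<in> G n" and eq: "b + x = b' + y"
    show "b = b'"
    proof (rule ccontr)
      assume "b \<noteq> b'"
      have "b \<in> B" "b' \<in> B" using b fB by (auto simp: C_def)
      have "f ` (B \<times> {..n}) \<subseteq> B - {b}"
      proof
        fix z assume "z \<in> f ` (B \<times> {..n})"
        then obtain a m where a: "a \<in> B" "m \<le> n" "z = f (a, m)" by auto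
        obtain a' where a': "a' \<in> B" "b = f (a', Suc n)" 
          using b(1) unfolding C_def by blast
        have "z \<noteq> b"
        proof
          assume "z = b"
          then have "f (a, m) = f (a', Suc n)" using a(3) a'(2) by metis
          then have "(a, m) = (a', Suc n)" by (rule inj_onD [OF f_inj]) (use a a' in auto)
          then show False using a(2) by simp
        qed
        moreover have "z \<in> B" unfolding a(3) using a(1) by (intro fB) simp
        ultimately show "z \<in> B - {b}" by simp
      qed
      then have GB: "G n \<subseteq> Q.span (B - {b})" unfolding G_def by (rule Q.span_mono)
      have "b' \<in> B - {b}" using \<open>b' \<in> B\<close> \<open>b \<noteq> b'\<close> by simp
      then have "b' + y - x \<in> Q.span (B - {b})"
        by (intro Q.span_diff Q.span_add Q.span_base subsetD [OF GB] xy)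
      moreover have "b = b' + y - x" using eq by (simp add: eq_diff_eq)
      ultimately have "b \<in> Q.span (B - {b})" by metis
      then show False using B(1) \<open>b \<in> B\<close> unfolding Q.dependent_def by blast
    qed
  qed
qed

lemma outer_measure_pos:
  fixes A :: "real set"
  assumes "\<not> negligible A"
  obtains n where "ennreal (1 / Suc n) < outer_measure_of lebesgue A"
proof -
  have "outer_measure_of lebesgue A \<noteq> 0"
  proof
    assume 0: "outer_measure_of lebesgue A = 0"
    obtain E where "E \<in> sets lebesgue" "A \<subseteq> E" "outer_measure_of lebesgue A = emeasure lebesgue E"
      using outer_measure_of_attain [of A lebesgue] by auto
    then have "negligible E" using 0 by (auto simp: negligible_iff_null_sets)
    then show False using assms \<open>A \<subseteq> E\<close> negligible_subset by blast
  qed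
  then obtain y where y: "0 < y" "y < outer_measure_of lebesgue A"
    using dense [of 0 "outer_measure_of lebesgue A"] by (auto simp: zero_less_iff_neq_zero)
  then obtain r where r: "y = ennreal r" "0 < r"
    by (cases y) (auto simp: ennreal_less_zero_iff)
  obtain n where "1 / Suc n < r" using nat_approx_posE [OF r(2)] by blast
  then have "ennreal (1 / Suc n) < y" using r by (simp add: ennreal_lessI)
  then show ?thesis using that y(2) by (meson less_trans)
qed

text \<open>
One of the groups \<open>G n\<close> is not negligible, so none of its uncountably many cosets is. Each coset then
has positive outer measure in some unit interval; uncountably many of them share the interval
and a lower bound for the outer measure.
\<close>

lemma uncountable_disjoint_thick_family:
  obtains S :: "real \<Rightarrow> real set" and L :: "real set" and \<theta> :: real
  where "uncountable L" "0 < \<theta>"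
    "\<And>l. l \<in> L \<Longrightarrow> S l \<subseteq> {0..1}"
    "\<And>l. l \<in> L \<Longrightarrow> ennreal \<theta> < outer_measure_of lebesgue (S l)"
    "\<And>l m t. \<lbrakk>l \<in> L; m \<in> L; t \<in> S l; t \<in> S m\<rbrakk> \<Longrightarrow> l = m"
proof -
  obtain G C :: "nat \<Rightarrow> real set"
    where G: "(\<Union>n. G n) = UNIV" and C: "\<And>n. uncountable (C n)"
      and disj: "\<And>n b b' x y. \<lbrakk>b \<in> C n; b' \<in> C n; x \<in> G n; y \<in> G n; b + x = b' + y\<rbrakk> \<Longrightarrow> b = b'"
    using real_union_of_groups_with_uncountably_many_cosets by blast
  have "\<exists>n. \<not> negligible (G n)"
  proof (rule ccontr)
    assume "\<not> ?thesis"
    then have "negligible (\<Union> (range G))" by (intro negligible_countable_Union) auto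
    then show False using G by (simp add: non_negligible_UNIV)
  qed
  then obtain n where n: "\<not> negligible (G n)" by blast
  \<comment> \<open>The part of the coset \<open>b + G n\<close> in \<open>[k, k + 1]\<close>, moved back to the unit interval.\<close>
  define S where "S = (\<lambda>(k::int) b. (+) (b - k) ` G n \<inter> {0..1})"
  have "\<exists>p. ennreal (1 / Suc (snd p)) < outer_measure_of lebesgue (S (fst p) b)" for b
  proof -
    have "\<exists>k. \<not> negligible (S k b)"
    proof (rule ccontr)
      assume "\<not> ?thesis"
      then have "negligible (\<Union>k. (+) (k - b) ` S k b)"
        by (intro negligible_countable_Union) (auto intro: negligible_translation)
      moreover have "G n \<subseteq> (\<Union>k. (+) (k - b) ` S k b)"
      proof
        fix x assume "x \<in> G n"
        define k where "k = \<lfloor>b + x\<rfloor>"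
        have "0 \<le> b - k + x" "b - k + x \<le> 1" unfolding k_def by linarith+
        then have "b - k + x \<in> S k b" using \<open>x \<in> G n\<close> by (auto simp: S_def)
        moreover have "x = (k - b) + (b - k + x)" by simp
        ultimately show "x \<in> (\<Union>k. (+) (k - b) ` S k b)" by blast
      qed
      ultimately show False using n negligible_subset by blast
    qed
    then obtain k where "\<not> negligible (S k b)" by blast
    then obtain m where "ennreal (1 / Suc m) < outer_measure_of lebesgue (S k b)"
      using outer_measure_pos by blast
    then show ?thesis by (intro exI [of _ "(k, m)"]) simp
  qed
  then obtain p :: "int \<times> nat"
    where unc: "uncountable {b \<in> C n. ennreal (1 / Suc (snd p)) < outer_measure_of lebesgue (S (fst p) b)}"
    using uncountable_fiber [OF C, of n "\<lambda>b p. ennreal (1 / Suc (snd p)) < outer_measure_of lebesgue (S (fst p) b)"]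
    by blast
  show ?thesis
  proof
    show "uncountable {b \<in> C n. ennreal (1 / Suc (snd p)) < outer_measure_of lebesgue (S (fst p) b)}"
      by (rule unc)
    show "l = m" if lm: "l \<in> {b \<in> C n. ennreal (1 / Suc (snd p)) < outer_measure_of lebesgue (S (fst p) b)}"
      "m \<in> {b \<in> C n. ennreal (1 / Suc (snd p)) < outer_measure_of lebesgue (S (fst p) b)}"
      "t \<in> S (fst p) l" "t \<in> S (fst p) m" for l m t
    proof -
      obtain x y where "x \<in> G n" "y \<in> G n" "t = l - fst p + x" "t = m - fst p + y"
        using lm(3,4) by (auto simp: S_def)
      then show ?thesis using lm(1,2) disj [of l n m x y] by simp
    qed
  qed (auto simp: S_def)
qed

text \<open>
The grid intervals that meet \<open>A\<close> cover it.
\<close>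

lemma outer_measure_le_grid_count:
  fixes q :: nat and \<theta> :: real
  assumes "A \<subseteq> {0..1}" "ennreal \<theta> < outer_measure_of lebesgue A" "0 < q"
  shows "\<theta> * q \<le> card {k. k < q \<and> A \<inter> {k / q..Suc k / q} \<noteq> {}}"
proof -
  define R where "R = {k. k < q \<and> A \<inter> {k / q..Suc k / q} \<noteq> {}}"
  have fin: "finite R" by (rule finite_subset [of _ "{..<q}"]) (auto simp: R_def)
  have "A \<subseteq> (\<Union>k\<in>R. {k / q..Suc k / q})"
  proof
    fix t assume t: "t \<in> A"
    then have "0 \<le> t" "t \<le> 1" using assms(1) by auto
    have "\<exists>k<q. t \<in> {k / q..Suc k / q}"
    proof (cases "t = 1")
      case True
      \<comment> \<open>The right end point belongs to no half-open grid interval.\<close>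
      then show ?thesis using assms(3) by (intro exI [of _ "q - 1"]) auto
    next
      case False
      define k where "k = nat \<lfloor>t * q\<rfloor>"
      have "k \<le> t * q" "t * q < Suc k" using \<open>0 \<le> t\<close> by (simp_all add: k_def) linarith
      moreover have "t * q < q" using False \<open>t \<le> 1\<close> assms(3) by simp
      moreover from calculation have "real k < real q" by linarith
      ultimately have "k < q" "t \<in> {k / q..Suc k / q}" using assms(3) by (auto simp: field_simps)
      then show ?thesis by blast
    qed
    then obtain k where "k < q" "t \<in> {k / q..Suc k / q}" by blast
    then have "k \<in> R" using t unfolding R_def by blast
    then show "t \<in> (\<Union>k\<in>R. {k / q..Suc k / q})" using \<open>t \<in> {k / q..Suc k / q}\<close> by blast
  qed
  then have "outer_measure_of lebesgue A \<le> outer_measure_of lebesgue (\<Union>k\<in>R. {k / q..Suc k / q})"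
    by (rule outer_measure_of_mono)
  also have "\<dots> = emeasure lebesgue (\<Union>k\<in>R. {k / q..Suc k / q})"
    using fin by (intro outer_measure_of_eq sets.finite_UN) auto
  also have "\<dots> \<le> (\<Sum>k\<in>R. emeasure lebesgue {k / q..Suc k / q})"
    using fin by (intro emeasure_subadditive_finite) auto
  also have "\<dots> = (\<Sum>k\<in>R. ennreal (1 / q))"
  proof (rule sum.cong [OF refl])
    fix k assume "k \<in> R"
    have "real (Suc k) / q - k / q = 1 / q" by (simp flip: diff_divide_distrib)
    moreover have "k / q \<le> real (Suc k) / q" by (simp add: divide_right_mono)
    ultimately show "emeasure lebesgue {k / q..Suc k / q} = ennreal (1 / q)"
      by (simp add: emeasure_completion)
  qed
  also have "\<dots> = ennreal (card R / q)" by (simp add: ennreal_of_nat_eq_real_of_nat flip: ennreal_mult)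
  finally have "ennreal \<theta> < ennreal (card R / q)" using assms(2) by order
  then have "\<theta> < card R / q" by (metis ennreal_leI not_le)
  then show ?thesis using assms(3) by (simp add: R_def field_simps)
qed

text \<open>
A case of the marriage theorem in which a greedy choice succeeds.
\<close>

lemma distinct_representatives:
  assumes "finite H" "\<And>h. h \<in> H \<Longrightarrow> card H \<le> card (R h)" "\<And>h. h \<in> H \<Longrightarrow> finite (R h)"
  shows "\<exists>k. inj_on k H \<and> (\<forall>h\<in>H. k h \<in> R h)"
  using assms
proof (induction H rule: finite_induct)
  case (insert h H)
  then obtain k where k: "inj_on k H" "\<forall>h\<in>H. k h \<in> R h" by fastforce
  have "card (k ` H) < card (R h)"
    using insert card_image [OF k(1)] by fastforce
  then have "\<not> R h \<subseteq> k ` H" using insert.hyps(1) card_mono by (metis finite_imageI not_le)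
  then obtain r where "r \<in> R h" "r \<notin> k ` H" by blast
  then have "inj_on (k(h := r)) (insert h H) \<and> (\<forall>g\<in>insert h H. (k(h := r)) g \<in> R g)"
    using k insert.hyps(2) by (auto simp: inj_on_def)
  then show ?case by blast
qed simp

section \<open>Blocks adapted to a gauge\<close>

text \<open>
The value \<open>0\<close> for equal labels prevents two points with the same label from lying in a common block.
\<close>

definition label_rank :: "('a \<Rightarrow> real) \<Rightarrow> 'a \<Rightarrow> 'a \<Rightarrow> nat"
  where "label_rank g s t = (if g s = g t then 0 else nat \<lfloor>1 / \<bar>g s - g t\<bar>\<rfloor>)"

text \<open>
The points of \<open>S l\<close> where the gauge exceeds \<open>1 / (n + 1)\<close> form a set \<open>A l n\<close> that increases with
\<open>n\<close> to \<open>S l\<close>, so continuity of the outer measure from below makes one of these sets thick for each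
\<open>l\<close>. The disjointness of the sets \<open>S l\<close> enters through the labelling \<open>g\<close>,
and their uncountable number through the two applications of the pigeonhole principle, to \<open>n\<close> and to
\<open>j\<close>; the labels that share \<open>j\<close> lie in an interval of length \<open>1 / q\<close>.
\<close>

lemma block_in_every_gauge:
  fixes L :: "real set" and S :: "real \<Rightarrow> real set" and \<theta> :: real
  assumes L: "uncountable L" and \<theta>: "0 < \<theta>"
    and S01: "\<And>l. l \<in> L \<Longrightarrow> S l \<subseteq> {0..1}"
    and thick: "\<And>l. l \<in> L \<Longrightarrow> ennreal \<theta> < outer_measure_of lebesgue (S l)"
    and g: "\<And>l t. \<lbrakk>l \<in> L; t \<in> S l\<rbrakk> \<Longrightarrow> g t = l"
    and \<delta>: "\<And>t. t \<in> {0..1} \<Longrightarrow> 0 < \<delta> t"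
  obtains q :: nat and F :: "real set" and k :: "real \<Rightarrow> nat"
  where "0 < q" "F \<in> blocks (label_rank g)" "\<theta> * q \<le> card F" "inj_on k F"
    "\<And>t. t \<in> F \<Longrightarrow> k t < q \<and> t \<in> {k t / q..Suc (k t) / q} \<and> 1 / q < \<delta> t"
proof -
  define A where "A = (\<lambda>l n. {t \<in> S l. 1 / real (Suc n) < \<delta> t})"
  have "\<exists>n. ennreal \<theta> < outer_measure_of lebesgue (A l n)" if l: "l \<in> L" for l
  proof -
    have "incseq (A l)"
    proof (rule incseq_SucI, rule subsetI)
      fix n t assume "t \<in> A l n"
      moreover have "1 / real (Suc (Suc n)) \<le> 1 / real (Suc n)" by (simp add: frac_le)
      ultimately show "t \<in> A l (Suc n)" unfolding A_def by force
    qed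
    moreover have "(\<Union>n. A l n) = S l"
    proof (intro equalityI subsetI)
      fix t assume t: "t \<in> S l"
      then have "0 < \<delta> t" using \<delta> S01 l by blast
      then obtain n where "1 / real (Suc n) < \<delta> t" by (rule nat_approx_posE)
      then show "t \<in> (\<Union>n. A l n)" using t by (auto simp: A_def)
    qed (auto simp: A_def)
    ultimately have "(SUP n. outer_measure_of lebesgue (A l n)) = outer_measure_of lebesgue (S l)"
      using SUP_outer_measure_of_incseq [of "A l" lebesgue] by simp
    then have "ennreal \<theta> < (SUP n. outer_measure_of lebesgue (A l n))" using thick [OF l] by simp
    then show ?thesis by (simp add: less_SUP_iff)
  qed
  with L obtain n where n: "uncountable {l \<in> L. ennreal \<theta> < outer_measure_of lebesgue (A l n)}"
    by (rule uncountable_fiber)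
  define L' where "L' = {l \<in> L. ennreal \<theta> < outer_measure_of lebesgue (A l n)}"
  define q where "q = Suc n"
  have "\<exists>j. \<lfloor>l * q\<rfloor> = j" for l by blast
  then obtain j where "uncountable {l \<in> L'. \<lfloor>l * q\<rfloor> = j}"
    using uncountable_fiber [of L' "\<lambda>l j. \<lfloor>l * q\<rfloor> = j"] n unfolding L'_def by blast
  then have "infinite {l \<in> L'. \<lfloor>l * q\<rfloor> = j}" using countable_finite by blast
  then obtain H where H: "finite H" "card H = nat \<lceil>\<theta> * q\<rceil>" "H \<subseteq> {l \<in> L'. \<lfloor>l * q\<rfloor> = j}"
    using infinite_arbitrarily_large by blast
  define R where "R = (\<lambda>l. {k. k < q \<and> A l n \<inter> {k / real q..Suc k / real q} \<noteq> {}})"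
  have R: "finite (R l)" "card (R l) \<le> q" for l
  proof -
    have "R l \<subseteq> {..<q}" by (auto simp: R_def)
    then show "finite (R l)" "card (R l) \<le> q"
      using finite_subset card_mono [of "{..<q}" "R l"] by auto
  qed
  have card_R: "card H \<le> card (R l)" if "l \<in> H" for l
  proof -
    have l: "l \<in> L" "ennreal \<theta> < outer_measure_of lebesgue (A l n)" using that H(3) by (auto simp: L'_def)
    have "A l n \<subseteq> {0..1}" using S01 [OF l(1)] by (auto simp: A_def)
    then have "\<theta> * q \<le> card (R l)"
      unfolding R_def using l(2) by (rule outer_measure_le_grid_count) (simp add: q_def)
    then show ?thesis unfolding H(2) by (simp add: nat_le_iff ceiling_le_iff)
  qed
  have "\<exists>r. inj_on r H \<and> (\<forall>l\<in>H. r l \<in> R l)"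
    by (rule distinct_representatives [OF H(1) card_R R(1)])
  then obtain r where r: "inj_on r H" "\<And>l. l \<in> H \<Longrightarrow> r l \<in> R l" by blast
  have "\<exists>t. t \<in> A l n \<and> t \<in> {r l / real q..Suc (r l) / real q}" if "l \<in> H" for l
    using r(2) [OF that] unfolding R_def by blast
  then obtain t where t: "\<And>l. l \<in> H \<Longrightarrow> t l \<in> A l n"
    "\<And>l. l \<in> H \<Longrightarrow> t l \<in> {r l / real q..Suc (r l) / real q}" by metis
  have gt: "g (t l) = l" if "l \<in> H" for l
    using g [of l "t l"] t(1) [OF that] H(3) that by (auto simp: A_def L'_def)
  have inj_t: "inj_on t H" using gt by (metis inj_onI)
  have card: "card (t ` H) = nat \<lceil>\<theta> * q\<rceil>" using card_image [OF inj_t] H(2) by simp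
  show ?thesis
  proof
    show "0 < q" by (simp add: q_def)
    show "\<theta> * q \<le> card (t ` H)" unfolding card by linarith
    have "card (t ` H) \<le> q"
    proof (cases "H = {}")
      case False
      then obtain l where "l \<in> H" by blast
      then show ?thesis
        using card_R [of l] R(2) [of l] card_image [OF inj_t] by simp
    qed simp
    moreover have "q \<le> label_rank g (t l) (t m)" if "l \<in> H" "m \<in> H" "t l \<noteq> t m" for l m
    proof -
      have "\<lfloor>l * q\<rfloor> = \<lfloor>m * q\<rfloor>" using H(3) that by auto
      then have "\<bar>l * q - m * q\<bar> < 1" by linarith
      then have "\<bar>l - m\<bar> * q < 1" by (simp add: abs_mult flip: left_diff_distrib)
      moreover have "l \<noteq> m" using that by blast
      ultimately have "real q < 1 / \<bar>l - m\<bar>" by (simp add: field_simps)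
      then have "int q \<le> \<lfloor>1 / \<bar>l - m\<bar>\<rfloor>" by (simp add: le_floor_iff)
      then show ?thesis using gt that \<open>l \<noteq> m\<close> by (simp add: label_rank_def le_nat_iff)
    qed
    ultimately show "t ` H \<in> blocks (label_rank g)"
      unfolding blocks_def using H(1) by (auto intro: order_trans)
    show "inj_on (r \<circ> g) (t ` H)"
      by (rule inj_onI) (use r(1) gt in \<open>auto dest: inj_onD\<close>)
    show "(r \<circ> g) s < q \<and> s \<in> {(r \<circ> g) s / q..Suc ((r \<circ> g) s) / q} \<and> 1 / q < \<delta> s"
      if s: "s \<in> t ` H" for s
    proof -
      obtain l where l: "l \<in> H" "s = t l" using s by blast
      have "r l < q" using r(2) [OF l(1)] by (simp add: R_def)
      moreover have "1 / q < \<delta> s" using t(1) [OF l(1)] by (simp add: A_def q_def l(2))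
      ultimately show ?thesis using t(2) [OF l(1)] gt [OF l(1)] l(2) by simp
    qed
  qed
qed

section \<open>Fine partitions with prescribed pieces\<close>

definition fine_partition :: "(real \<Rightarrow> real) \<Rightarrow> real \<Rightarrow> real \<Rightarrow> (real set \<times> real) set \<Rightarrow> bool"
  where "fine_partition \<delta> a b P \<longleftrightarrow> finite P \<and>
    (\<forall>(I, t)\<in>P. (\<exists>u v. a \<le> u \<and> u < v \<and> v \<le> b \<and> I = {u..v}) \<and> t \<in> I \<and> I \<subseteq> {t - \<delta> t<..<t + \<delta> t}) \<and>
    (\<forall>p\<in>P. \<forall>p'\<in>P. p \<noteq> p' \<longrightarrow> interior (fst p) \<inter> interior (fst p') = {}) \<and>
    (\<Union>(I, t)\<in>P. I) = {a..b}"

lemma fine_partition_single: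
  assumes "a < b" "t \<in> {a..b}" "b - a < \<delta> t"
  shows "fine_partition \<delta> a b {({a..b}, t)}"
  using assms by (auto simp: fine_partition_def)

lemma
  assumes "fine_partition \<delta> a b P"
  shows fine_partition_finite: "finite P"
    and fine_partition_nonoverlapping:
      "\<forall>p\<in>P. \<forall>p'\<in>P. p \<noteq> p' \<longrightarrow> interior (fst p) \<inter> interior (fst p') = {}"
    and fine_partition_cover: "(\<Union>(I, t)\<in>P. I) = {a..b}"
proof -
  show "finite P"
    using assms unfolding fine_partition_def by (elim conjE)
  show "\<forall>p\<in>P. \<forall>p'\<in>P. p \<noteq> p' \<longrightarrow> interior (fst p) \<inter> interior (fst p') = {}"
    using assms unfolding fine_partition_def by (elim conjE)
  show "(\<Union>(I, t)\<in>P. I) = {a..b}"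
    using assms unfolding fine_partition_def by (elim conjE)
qed

lemma fine_partition_piece:
  assumes "fine_partition \<delta> a b P" "(I, t) \<in> P"
  shows "\<exists>u v. a \<le> u \<and> u < v \<and> v \<le> b \<and> I = {u..v}" "t \<in> I" "I \<subseteq> {t - \<delta> t<..<t + \<delta> t}"
proof -
  have "\<forall>(I, t)\<in>P. (\<exists>u v. a \<le> u \<and> u < v \<and> v \<le> b \<and> I = {u..v}) \<and> t \<in> I \<and> I \<subseteq> {t - \<delta> t<..<t + \<delta> t}"
    using assms(1) unfolding fine_partition_def by (elim conjE)
  from bspec [OF this assms(2)]
  show "\<exists>u v. a \<le> u \<and> u < v \<and> v \<le> b \<and> I = {u..v}" "t \<in> I" "I \<subseteq> {t - \<delta> t<..<t + \<delta> t}"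
    unfolding prod.case by blast+
qed

lemma fine_partition_Un:
  assumes P: "fine_partition \<delta> a b P" and Q: "fine_partition \<delta> b c Q" and "a < b" "b < c"
  shows "fine_partition \<delta> a c (P \<union> Q)"
proof -
  have cross: "interior (fst p) \<inter> interior (fst p') = {}" if "p \<in> P" "p' \<in> Q" for p p'
  proof -
    have "fst p \<subseteq> (\<Union>(I, t)\<in>P. I)" using that(1) by (cases p) auto
    moreover have "fst p' \<subseteq> (\<Union>(I, t)\<in>Q. I)" using that(2) by (cases p') auto
    ultimately have "fst p \<subseteq> {a..b}" "fst p' \<subseteq> {b..c}" 
      using fine_partition_cover [OF P] fine_partition_cover [OF Q] by simp_all
    then have "interior (fst p) \<subseteq> {a<..<b}" "interior (fst p') \<subseteq> {b<..<c}"
      using interior_mono interior_atLeastAtMost_real by metis+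
    then show ?thesis by force
  qed
  have "(\<Union>(I, t)\<in>P \<union> Q. I) = {a..b} \<union> {b..c}"
    using fine_partition_cover [OF P] fine_partition_cover [OF Q] by simp
  also have "\<dots> = {a..c}" using assms(3,4) by auto
  finally have cover: "(\<Union>(I, t)\<in>P \<union> Q. I) = {a..c}" .
  have disj: "interior (fst p) \<inter> interior (fst p') = {}"
    if "p \<in> P \<union> Q" "p' \<in> P \<union> Q" "p \<noteq> p'" for p p'
    using that cross fine_partition_nonoverlapping [OF P] fine_partition_nonoverlapping [OF Q]
    by (metis Un_iff inf_commute)
  have "(\<exists>u v. a \<le> u \<and> u < v \<and> v \<le> c \<and> I = {u..v}) \<and> t \<in> I \<and> I \<subseteq> {t - \<delta> t<..<t + \<delta> t}"
    if It: "(I, t) \<in> P \<union> Q" for I t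
  proof -
    consider "(I, t) \<in> P" | "(I, t) \<in> Q" using It by blast
    then show ?thesis
    proof cases
      case 1
      obtain u v where "a \<le> u" "u < v" "v \<le> b" "I = {u..v}"
        using fine_partition_piece(1) [OF P 1] by blast
      moreover from this have "v \<le> c" using assms(4) by simp
      ultimately show ?thesis using fine_partition_piece(2,3) [OF P 1] by blast
    next
      case 2
      obtain u v where "b \<le> u" "u < v" "v \<le> c" "I = {u..v}"
        using fine_partition_piece(1) [OF Q 2] by blast
      moreover from this have "a \<le> u" using assms(3) by simp
      ultimately show ?thesis using fine_partition_piece(2,3) [OF Q 2] by blast
    qed
  qed
  moreover have "finite (P \<union> Q)"
    using fine_partition_finite [OF P] fine_partition_finite [OF Q] by simp
  ultimately show ?thesis unfolding fine_partition_def using cover disj by blast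
qed

text \<open>
Cousin's lemma.
\<close>

lemma fine_partition_exists:
  assumes "a < b" "\<And>t. t \<in> {a..b} \<Longrightarrow> 0 < \<delta> t"
  shows "\<exists>P. fine_partition \<delta> a b P"
proof -
  have "a < b \<longrightarrow> (\<exists>P. fine_partition \<delta> a b P)"
  proof (rule Bolzano [where P = "\<lambda>a b. a < b \<longrightarrow> (\<exists>P. fine_partition \<delta> a b P)"])
    fix u v w :: real
    assume "u < v \<longrightarrow> (\<exists>P. fine_partition \<delta> u v P)" "v < w \<longrightarrow> (\<exists>P. fine_partition \<delta> v w P)"
      "u \<le> v" "v \<le> w"
    then show "u < w \<longrightarrow> (\<exists>P. fine_partition \<delta> u w P)"
      using fine_partition_Un by (metis order_le_less)
  next
    fix x assume x: "a \<le> x" "x \<le> b"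
    show "\<exists>d>0. \<forall>u v. u \<le> x \<and> x \<le> v \<and> v - u < d \<longrightarrow> u < v \<longrightarrow> (\<exists>P. fine_partition \<delta> u v P)"
    proof (intro exI [of _ "\<delta> x"] conjI allI impI)
      fix u v assume "u \<le> x \<and> x \<le> v \<and> v - u < \<delta> x" "u < v"
      then show "\<exists>P. fine_partition \<delta> u v P"
        using fine_partition_single [of u v x \<delta>] by auto
    qed (use assms(2) x in auto)
  qed (use assms(1) in simp)
  then show ?thesis using assms(1) by blast
qed

lemma fine_partition_01:
  assumes "fine_partition \<delta> 0 1 P"
  shows "perron_partition01 P" "delta_fine \<delta> P"
proof -
  have sub: "I \<in> subintervals \<and> t \<in> I \<and> t \<in> {0..1} \<and> I \<subseteq> {t - \<delta> t<..<t + \<delta> t}" if It: "(I, t) \<in> P" for I t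
  proof -
    obtain u v where uv: "0 \<le> u" "u < v" "v \<le> 1" "I = {u..v}"
      using fine_partition_piece(1) [OF assms It] by blast
    then have "I \<in> subintervals" unfolding subintervals_def by blast
    moreover have "t \<in> {0..1}" using uv fine_partition_piece(2) [OF assms It] by auto
    ultimately show ?thesis using fine_partition_piece(2,3) [OF assms It] by blast
  qed
  have "partition01 P"
    unfolding partition01_def
  proof (intro conjI)
    show "\<forall>(I, t)\<in>P. I \<in> subintervals \<and> t \<in> {0..1}" using sub by auto
  qed (rule fine_partition_finite [OF assms] fine_partition_nonoverlapping [OF assms]
      fine_partition_cover [OF assms])+
  then show "perron_partition01 P" using sub by (auto simp: perron_partition01_def)
  show "delta_fine \<delta> P" using sub unfolding delta_fine_def by auto
qed

text \<open>
Cousin's lemma fills the grid intervals that have no prescribed tag.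
\<close>

lemma fine_partition_with_prescribed_pieces:
  fixes q :: nat and k :: "real \<Rightarrow> nat"
  assumes \<delta>: "\<And>t. t \<in> {0..1} \<Longrightarrow> 0 < \<delta> t" and q: "0 < q" and inj: "inj_on k F"
    and k: "\<And>t. t \<in> F \<Longrightarrow> k t < q \<and> t \<in> {k t / q..Suc (k t) / q} \<and> 1 / q < \<delta> t"
  obtains P where "fine_partition \<delta> 0 1 P" "\<And>t. t \<in> F \<Longrightarrow> ({k t / q..Suc (k t) / q}, t) \<in> P"
proof -
  have lt: "m / q < Suc m / q" "Suc m / q - m / q = 1 / q" for m
    using q by (simp_all add: divide_strict_right_mono flip: diff_divide_distrib)
  have piece: "\<exists>P. fine_partition \<delta> (m / q) (Suc m / q) P \<and>
      (\<forall>t\<in>F. k t = m \<longrightarrow> ({m / q..Suc m / q}, t) \<in> P)" if "m < q" for m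
  proof (cases "m \<in> k ` F")
    case True
    then obtain t where t: "t \<in> F" "k t = m" by blast
    have "fine_partition \<delta> (m / q) (Suc m / q) {({m / q..Suc m / q}, t)}"
      using k [OF t(1)] t(2) lt [of m] by (intro fine_partition_single) auto
    moreover have "s = t" if "s \<in> F" "k s = m" for s using inj t that by (auto dest: inj_onD)
    ultimately show ?thesis by blast
  next
    case False
    have "0 < \<delta> t" if "t \<in> {m / q..Suc m / q}" for t
    proof (rule \<delta>)
      have "Suc m / real q \<le> 1" using \<open>m < q\<close> by simp
      moreover have "0 \<le> m / real q" by simp
      moreover have "m / real q \<le> t" "t \<le> Suc m / real q" using that by auto
      ultimately show "t \<in> {0..1}" unfolding atLeastAtMost_iff by linarith
    qed
    then have "\<exists>P. fine_partition \<delta> (m / q) (Suc m / q) P" using lt(1) by (intro fine_partition_exists)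
    then show ?thesis using False by blast
  qed
  have "\<exists>P. fine_partition \<delta> 0 (Suc m / q) P \<and>
      (\<forall>t\<in>F. k t \<le> m \<longrightarrow> ({k t / q..Suc (k t) / q}, t) \<in> P)" if "m < q" for m
    using that
  proof (induction m)
    case 0
    then show ?case using piece [of 0] by auto
  next
    case (Suc m)
    then obtain P where P: "fine_partition \<delta> 0 (Suc m / q) P"
      "\<forall>t\<in>F. k t \<le> m \<longrightarrow> ({k t / q..Suc (k t) / q}, t) \<in> P" by auto
    obtain Q where Q: "fine_partition \<delta> (Suc m / q) (Suc (Suc m) / q) Q"
      "\<forall>t\<in>F. k t = Suc m \<longrightarrow> ({Suc m / q..Suc (Suc m) / q}, t) \<in> Q"
      using piece [OF Suc.prems] by blast
    have "fine_partition \<delta> 0 (Suc (Suc m) / q) (P \<union> Q)"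
      using q lt(1) [of "Suc m"] by (intro fine_partition_Un [OF P(1) Q(1)]) auto
    moreover have "({k t / q..Suc (k t) / q}, t) \<in> P \<union> Q" if "t \<in> F" "k t \<le> Suc m" for t
    proof (cases "k t = Suc m")
      case True
      then show ?thesis using Q(2) that by (metis UnI2)
    next
      case False
      then show ?thesis using P(2) that by simp
    qed
    ultimately show ?case by blast
  qed
  from this [of "q - 1"] q obtain P where P: "fine_partition \<delta> 0 (Suc (q - 1) / q) P"
    "\<forall>t\<in>F. k t \<le> q - 1 \<longrightarrow> ({k t / q..Suc (k t) / q}, t) \<in> P" by auto
  have "fine_partition \<delta> 0 1 P" using P(1) q by simp
  moreover have "({k t / q..Suc (k t) / q}, t) \<in> P" if "t \<in> F" for t
    using P(2) k [OF that] that by force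
  ultimately show ?thesis using that by blast
qed

section \<open>The Riemann sums of the unit vectors\<close>

definition tagged_sum :: "(real set \<times> real) set \<Rightarrow> real \<Rightarrow> real"
  where "tagged_sum P = (\<Sum>(I, t)\<in>P. measure lborel I *\<^sub>R unit_vector t)"

lemma tagged_sum_apply:
  assumes "finite P"
  shows "tagged_sum P s = (\<Sum>p\<in>{p \<in> P. snd p = s}. measure lborel (fst p))"
proof -
  have sum_apply: "(\<Sum>p\<in>A. h p) s = (\<Sum>p\<in>A. h p s)" for A and h :: "real set \<times> real \<Rightarrow> real \<Rightarrow> real"
    by (induction A rule: infinite_finite_induct) auto
  have "tagged_sum P s = (\<Sum>p\<in>P. if snd p = s then measure lborel (fst p) else 0)"
    unfolding tagged_sum_def sum_apply
    by (intro sum.cong refl) (auto simp: unit_vector_def indicator_def)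
  also have "\<dots> = (\<Sum>p\<in>{p \<in> P. snd p = s}. measure lborel (fst p))"
    using assms by (simp add: sum.If_cases Int_def)
  finally show ?thesis .
qed

lemma tagged_sum_in_space:
  assumes "finite P" shows "tagged_sum P \<in> baernstein_space c"
proof (rule finite_support_in_space [of "snd ` P"])
  fix s assume "s \<notin> snd ` P"
  then have "{p \<in> P. snd p = s} = {}" by force
  then show "tagged_sum P s = 0" unfolding tagged_sum_apply [OF assms] by (simp only: sum.empty)
qed (use assms in simp)

lemma tagged_sum_nonneg:
  assumes "finite P" shows "0 \<le> tagged_sum P s"
  unfolding tagged_sum_apply [OF assms] by (intro sum_nonneg) simp

lemma measure_le_tagged_sum:
  assumes "finite P" "(I, s) \<in> P"
  shows "measure lborel I \<le> tagged_sum P s"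
  using member_le_sum [of "(I, s)" "{p \<in> P. snd p = s}" "\<lambda>p. measure lborel (fst p)"] assms
  by (simp add: tagged_sum_apply)

text \<open>
All intervals with the tag \<open>s\<close> lie within \<open>\<eta>\<close> of \<open>s\<close>, and they do not overlap.
\<close>

lemma tagged_sum_le_gauge:
  assumes P: "partition01 P" "delta_fine \<delta> P" and "\<delta> s \<le> \<eta>" "0 < \<eta>"
  shows "tagged_sum P s \<le> 2 * \<eta>"
proof -
  define P' where "P' = {p \<in> P. snd p = s}"
  have fin: "finite P" "finite P'" using P(1) by (auto simp: partition01_def P'_def)
  have interval: "\<exists>a b. fst p = {a..b} \<and> a < b" "fst p \<subseteq> {s - \<eta>..s + \<eta>}" if pP': "p \<in> P'" for p
  proof -
    obtain I where p: "p = (I, s)" "(I, s) \<in> P" using pP' by (cases p) (auto simp: P'_def)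
    then have "I \<in> subintervals" using P(1) by (auto simp: partition01_def)
    then show "\<exists>a b. fst p = {a..b} \<and> a < b" by (auto simp: subintervals_def p)
    have "I \<subseteq> {s - \<delta> s<..<s + \<delta> s}" using P(2) p(2) by (auto simp: delta_fine_def)
    also have "\<dots> \<subseteq> {s - \<eta>..s + \<eta>}" using assms(3) by auto
    finally show "fst p \<subseteq> {s - \<eta>..s + \<eta>}" by (simp add: p)
  qed
  have meas: "fst p \<in> lmeasurable" "measure lebesgue (fst p) = measure lborel (fst p)" if "p \<in> P'" for p
    using interval(1) [OF that] by (auto simp: lmeasurable_compact)
  have "pairwise (\<lambda>p p'. negligible (fst p \<inter> fst p')) P'"
  proof (rule pairwiseI)
    fix p p' assume p: "p \<in> P'" "p' \<in> P'" "p \<noteq> p'"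
    then have "interior (fst p) \<inter> interior (fst p') = {}"
      using P(1) unfolding partition01_def P'_def by blast
    moreover have "convex (fst p \<inter> fst p')"
      using interval(1) p by (metis convex_Int convex_real_interval(5))
    ultimately show "negligible (fst p \<inter> fst p')" by (simp add: negligible_convex_interior)
  qed
  then have "measure lebesgue (\<Union> (fst ` P')) = (\<Sum>p\<in>P'. measure lebesgue (fst p))"
    using fin meas by (intro measure_negligible_finite_Union_image)
  also have "\<dots> = tagged_sum P s"
    unfolding tagged_sum_apply [OF fin(1)] P'_def [symmetric] using meas by (intro sum.cong) auto
  finally have "tagged_sum P s = measure lebesgue (\<Union> (fst ` P'))" ..
  also have "\<dots> \<le> measure lebesgue {s - \<eta>..s + \<eta>}"
  proof (rule measure_mono_fmeasurable)
    show "\<Union> (fst ` P') \<subseteq> {s - \<eta>..s + \<eta>}" using interval(2) by blast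
    show "\<Union> (fst ` P') \<in> sets lebesgue"
      using fin(2) meas(1) by (intro sets.finite_Union) (auto intro: fmeasurableD)
  qed (simp add: lmeasurable_compact)
  also have "\<dots> = 2 * \<eta>" using assms(4) by simp
  finally show ?thesis .
qed

text \<open>
Shrinking the gauge makes each coordinate of the Riemann sums small, so \<open>0\<close> is the only candidate
for the integral. The norms of the Riemann sums then contradict it.
\<close>

lemma unit_vector_not_Henstock:
  assumes \<theta>: "0 < \<theta>"
    and gauge: "\<And>\<delta>. (\<And>t. t \<in> {0..1} \<Longrightarrow> 0 < \<delta> t) \<Longrightarrow>
      \<exists>P F. fine_partition \<delta> 0 1 P \<and> F \<in> blocks c \<and> \<theta> \<le> (\<Sum>t\<in>F. tagged_sum P t)"
  shows "\<not> Henstock_integrable_on01 (baernstein_space c) (baernstein_norm c) unit_vector"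
proof
  assume "Henstock_integrable_on01 (baernstein_space c) (baernstein_norm c) unit_vector"
  then obtain y where y: "y \<in> baernstein_space c"
    and small: "\<And>\<epsilon>. 0 < \<epsilon> \<Longrightarrow> \<exists>\<delta>. gauge01 \<delta> \<and> (\<forall>P. perron_partition01 P \<and> delta_fine \<delta> P \<longrightarrow>
      baernstein_norm c (y - tagged_sum P) < \<epsilon>)"
    unfolding Henstock_integrable_on01_def tagged_sum_def by blast
  have y0: "y s = 0" for s
  proof -
    have "\<bar>y s\<bar> \<le> 0 + e" if "0 < e" for e
    proof -
      obtain \<delta> where \<delta>: "gauge01 \<delta>" "\<And>P. perron_partition01 P \<Longrightarrow> delta_fine \<delta> P \<Longrightarrow>
          baernstein_norm c (y - tagged_sum P) < e / 3"
        using small [of "e / 3"] \<open>0 < e\<close> by auto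
      \<comment> \<open>The extra bound keeps the coordinate \<open>s\<close> of the Riemann sum at most \<open>2 * e / 3\<close>.\<close>
      define \<delta>' where "\<delta>' = (\<lambda>t. min (\<delta> t) (e / 3))"
      have "0 < \<delta>' t" if "t \<in> {0..1}" for t
        using \<delta>(1) \<open>0 < e\<close> that by (simp add: \<delta>'_def gauge01_def)
      then have "\<exists>P. fine_partition \<delta>' 0 1 P" by (intro fine_partition_exists) auto
      then obtain P where P: "perron_partition01 P" "delta_fine \<delta>' P" using fine_partition_01 by blast
      have P01: "partition01 P" "finite P" using P(1) by (auto simp: perron_partition01_def partition01_def)
      have "delta_fine \<delta> P"
        unfolding delta_fine_def
      proof (intro ballI, clarify)
        fix I t x assume "(I, t) \<in> P" "x \<in> I"
        then have "x \<in> {t - \<delta>' t<..<t + \<delta>' t}" 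
          using bspec [OF P(2) [unfolded delta_fine_def] \<open>(I, t) \<in> P\<close>] by auto
        then show "x \<in> {t - \<delta> t<..<t + \<delta> t}" by (auto simp: \<delta>'_def)
      qed
      then have "\<bar>(y - tagged_sum P) s\<bar> < e / 3"
        using \<delta>(2) [OF P(1)] coordinate_le_norm [OF diff_in_space [OF y tagged_sum_in_space [OF P01(2)]]]
        by (meson le_less_trans)
      moreover have "tagged_sum P s \<le> 2 * (e / 3)"
        using \<open>0 < e\<close> by (intro tagged_sum_le_gauge [OF P01(1) P(2)]) (simp_all add: \<delta>'_def)
      ultimately show ?thesis
        using tagged_sum_nonneg [OF P01(2), of s] unfolding minus_fun_apply by linarith
    qed
    then have "\<bar>y s\<bar> \<le> 0" by (rule field_le_epsilon)
    then show ?thesis by simp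
  qed
  obtain \<delta> where \<delta>: "gauge01 \<delta>" "\<And>P. perron_partition01 P \<Longrightarrow> delta_fine \<delta> P \<Longrightarrow>
      baernstein_norm c (y - tagged_sum P) < \<theta>"
    using small [OF \<theta>] by auto
  have "0 < \<delta> t" if "t \<in> {0..1}" for t using \<delta>(1) that by (simp add: gauge01_def)
  then obtain P F where P: "fine_partition \<delta> 0 1 P" and F: "F \<in> blocks c" "\<theta> \<le> (\<Sum>t\<in>F. tagged_sum P t)"
    using gauge [of \<delta>] by blast
  have fin: "finite P" by (rule fine_partition_finite [OF P])
  have "(\<Sum>t\<in>F. tagged_sum P t) = (\<Sum>t\<in>F. \<bar>(y - tagged_sum P) t\<bar>)"
    using tagged_sum_nonneg [OF fin] by (simp add: y0)
  also have "\<dots> \<le> baernstein_norm c (y - tagged_sum P)"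
    by (intro sum_block_le_norm diff_in_space y tagged_sum_in_space fin F(1))
  also have "\<dots> < \<theta>" by (intro \<delta>(2) fine_partition_01 [OF P])
  finally show False using F(2) by simp
qed

theorem proposition3p2:
  shows "\<exists>(Y :: (real \<Rightarrow> real) set) (N :: (real \<Rightarrow> real) \<Rightarrow> real) (\<Gamma> :: real \<Rightarrow> (real \<Rightarrow> real) set).
    banach_space_on Y N \<and> reflexive_on Y N \<and>
    (\<forall>t\<in>{0..1}. \<Gamma> t \<in> cwk Y N) \<and>
    variationally_McShane_integrable Y N \<Gamma> \<and>
    (\<forall>t\<in>{0..1}. 0 \<in> \<Gamma> t) \<and>
    (\<exists>f. selection \<Gamma> f \<and> scalarly_measurable Y N f \<and> \<not> Henstock_integrable_on01 Y N f)"
proof -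
  obtain S :: "real \<Rightarrow> real set" and L :: "real set" and \<theta> :: real
    where L: "uncountable L" and \<theta>: "0 < \<theta>" and S01: "\<And>l. l \<in> L \<Longrightarrow> S l \<subseteq> {0..1}"
      and thick: "\<And>l. l \<in> L \<Longrightarrow> ennreal \<theta> < outer_measure_of lebesgue (S l)"
      and disj: "\<And>l m t. \<lbrakk>l \<in> L; m \<in> L; t \<in> S l; t \<in> S m\<rbrakk> \<Longrightarrow> l = m"
    using uncountable_disjoint_thick_family by metis
  define g where "g = (\<lambda>t. SOME l. l \<in> L \<and> t \<in> S l)"
  have g: "g t = l" if "l \<in> L" "t \<in> S l" for l t
  proof -
    have "g t \<in> L \<and> t \<in> S (g t)" unfolding g_def by (rule someI [of _ l]) (use that in simp)
    then show ?thesis using disj that by blast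
  qed
  define c where "c = label_rank g"
  have "\<exists>P F. fine_partition \<delta> 0 1 P \<and> F \<in> blocks c \<and> \<theta> \<le> (\<Sum>t\<in>F. tagged_sum P t)"
    if \<delta>: "\<And>t. t \<in> {0..1} \<Longrightarrow> 0 < \<delta> t" for \<delta>
  proof -
    obtain q :: nat and F :: "real set" and k :: "real \<Rightarrow> nat"
      where q: "0 < q" and F: "F \<in> blocks c" "\<theta> * q \<le> card F" and inj: "inj_on k F"
        and k: "\<And>t. t \<in> F \<Longrightarrow> k t < q \<and> t \<in> {k t / q..Suc (k t) / q} \<and> 1 / q < \<delta> t"
      unfolding c_def
      using block_in_every_gauge [of L \<theta> S g \<delta>, OF L \<theta> S01 thick g \<delta>] by blast
    obtain P where P: "fine_partition \<delta> 0 1 P"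
      "\<And>t. t \<in> F \<Longrightarrow> ({k t / q..Suc (k t) / q}, t) \<in> P"
      using fine_partition_with_prescribed_pieces [of \<delta> q k F, OF \<delta> q inj k] by blast
    have "1 / q \<le> tagged_sum P t" if "t \<in> F" for t
    proof -
      have "measure lborel {k t / q..Suc (k t) / q} = 1 / q"
        by (simp add: divide_right_mono flip: diff_divide_distrib)
      then show ?thesis
        using measure_le_tagged_sum [OF fine_partition_finite [OF P(1)] P(2) [OF that]] by simp
    qed
    then have "card F * (1 / q) \<le> (\<Sum>t\<in>F. tagged_sum P t)"
      by (intro sum_bounded_below)
    moreover have "\<theta> \<le> card F * (1 / q)" using F(2) q by (simp add: field_simps)
    ultimately show ?thesis using P(1) F(1) by (intro exI [of _ P] exI [of _ F]) auto
  qed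
  then have not_Henstock:
    "\<not> Henstock_integrable_on01 (baernstein_space c) (baernstein_norm c) unit_vector"
    by (rule unit_vector_not_Henstock [OF \<theta>])
  have "selection (\<lambda>_. baernstein_ball c 1) unit_vector"
    by (simp add: selection_def baernstein_ball_def unit_vector_in_space baernstein_norm_unit_vector_le)
  then have f: "\<exists>f. selection (\<lambda>_. baernstein_ball c 1) f \<and>
      scalarly_measurable (baernstein_space c) (baernstein_norm c) f \<and>
      \<not> Henstock_integrable_on01 (baernstein_space c) (baernstein_norm c) f"
    using unit_vector_scalarly_measurable not_Henstock by blast
  have "0 \<in> baernstein_ball c 1"
    using baernstein_norm_scaleR [OF zero_in_space, of c 0] by (simp add: baernstein_ball_def zero_in_space)
  moreover have "baernstein_ball c 1 \<in> cwk (baernstein_space c) (baernstein_norm c)"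
    by (rule baernstein_ball_cwk) simp
  ultimately show ?thesis
    using baernstein_space_banach [of c] baernstein_space_reflexive [of c]
      constant_ball_variationally_McShane [of c] f
    by (intro exI [of _ "baernstein_space c"] exI [of _ "baernstein_norm c"]
        exI [of _ "\<lambda>_. baernstein_ball c 1"]) simp
qed

end
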